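(* Let $\theta\in\,]0,1[$ be fixed and, for $n\in\mathbb{N}$, let $m=\lfloor\theta n\rfloor$ (with $m\ge1$). Then for every $1\le p\le\infty$ there is a constant $\mathcal{C}_p>0$ depending only on $p$ such that, for every function $f$ defined on $[-1,1]$, $$\|\tilde S_n^mf\|_p\le\mathcal{C}_p\|f\|_{\ell^p(X_n)}.$$ Moreover, for every $f\in C^0([-1,1])$, $\tilde S_n^mf\to f$ uniformly on $[-1,1]$ as $n\to\infty$, and $$E_{n+m-1}(f)_\infty\le\|\tilde S_n^mf-f\|_\infty\le\mathcal{C}\,E_{n-m}(f)_\infty$$ with $\mathcal{C}>0$ independent of $f,n,m$.
   Context: Let $w(x)=(1-x^2)^{-1/2}$ on $[-1,1]$, $\|f\|_\infty=\sup_{|x|\le1}|f(x)|$, $\|f\|_p=(\int_{-1}^1|f|^pw\,dx)^{1/p}$ for $1\le p<\infty$, and $E_N(f)_\infty=\inf_{P\in\mathbb{P}_N}\|f-P\|_\infty$ with $\mathbb{P}_N$ the polynomials of degree at most $N$. Chebyshev nodes: $X_n=\{x_k^n=\cos\frac{(2k-1)\pi}{2n}: k=1,\ldots,n\}$; discrete norms $\|f\|_{\ell^\infty(X_n)}=\max_k|f(x_k^n)|$ and $\|f\|_{\ell^p(X_n)}=(\frac{\pi}{n}\sum_{k=1}^n|f(x_k^n)|^p)^{1/p}$ for $1\le p<\infty$. The orthonormal Chebyshev polynomials are $p_0=\sqrt{1/\pi}$, $p_r(x)=\sqrt{2/\pi}\cos(r\arccos x)$, $r\ge1$. For $0<m<n$: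 $\mu_{n,r}^m=1$ if $0\le r\le n-m$, $\frac{m+n-r}{2m}$ if $n-m<r<n+m$, $0$ otherwise; for $r=0,\ldots,n-1$, $q_{n,r}^m=p_r$ if $r\le n-m$ and $q_{n,r}^m=\mu_{n,r}^mp_r-\mu_{n,2n-r}^mp_{2n-r}$ if $n-m<r<n$; $\nu_{n,r}^m=1$ if $r\le n-m$, $\frac{m^2+(n-r)^2}{2m^2}$ if $n-m<r<n$. Orthonormal VP scaling functions: $\tilde\varphi_{n,k}^m=\sum_{r=0}^{n-1}\sqrt{\frac{\pi}{n\nu_{n,r}^m}}p_r(x_k^n)q_{n,r}^m$, $k=1,\ldots,n$. The discrete projection is $\tilde S_n^mf(x)=\sum_{k=1}^n\Big[\frac{\pi}{n}\sum_{i=1}^nf(x_i^n)\tilde\varphi_{n,k}^m(x_i^n)\Big]\tilde\varphi_{n,k}^m(x)$. *)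

theory Defs
  imports "HOL-Analysis.Analysis" "HOL-Computational_Algebra.Polynomial"
begin

definition cheb_node :: "nat \<Rightarrow> nat \<Rightarrow> real" where
  "cheb_node n k = cos ((2 * real k - 1) * pi / (2 * real n))"

definition cheb_p :: "nat \<Rightarrow> real \<Rightarrow> real" where
  "cheb_p r x = (if r = 0 then sqrt (1 / pi) else sqrt (2 / pi) * cos (real r * arccos x))"

definition vp_mu :: "nat \<Rightarrow> nat \<Rightarrow> nat \<Rightarrow> real" where
  "vp_mu n m r =
     (if r + m \<le> n then 1
      else if r < n + m then (real m + real n - real r) / (2 * real m)
      else 0)"

definition vp_q :: "nat \<Rightarrow> nat \<Rightarrow> nat \<Rightarrow> real \<Rightarrow> real" where
  "vp_q n m r x =
     (if r + m \<le> n then cheb_p r x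
      else vp_mu n m r * cheb_p r x - vp_mu n m (2 * n - r) * cheb_p (2 * n - r) x)"

definition vp_nu :: "nat \<Rightarrow> nat \<Rightarrow> nat \<Rightarrow> real" where
  "vp_nu n m r =
     (if r + m \<le> n then 1
      else (real m ^ 2 + (real n - real r) ^ 2) / (2 * real m ^ 2))"

definition vp_phi :: "nat \<Rightarrow> nat \<Rightarrow> nat \<Rightarrow> real \<Rightarrow> real" where
  "vp_phi n m k x =
     (\<Sum>r<n. sqrt (pi / (real n * vp_nu n m r)) * cheb_p r (cheb_node n k) * vp_q n m r x)"

definition vp_S :: "nat \<Rightarrow> nat \<Rightarrow> (real \<Rightarrow> real) \<Rightarrow> real \<Rightarrow> real" where
  "vp_S n m f x =
     (\<Sum>k=1..n. ((pi / real n) * (\<Sum>i=1..n. f (cheb_node n i) * vp_phi n m k (cheb_node n i)))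
                 * vp_phi n m k x)"

definition sup_norm :: "(real \<Rightarrow> real) \<Rightarrow> real" where
  "sup_norm g = Sup ((\<lambda>x. \<bar>g x\<bar>) ` {-1..1})"

definition w_norm :: "ereal \<Rightarrow> (real \<Rightarrow> real) \<Rightarrow> real" where
  "w_norm p g =
     (if p = \<infinity> then sup_norm g
      else (LBINT x=-1..1. \<bar>g x\<bar> powr (real_of_ereal p) / sqrt (1 - x\<^sup>2))
             powr (1 / real_of_ereal p))"

definition l_norm :: "ereal \<Rightarrow> nat \<Rightarrow> (real \<Rightarrow> real) \<Rightarrow> real" where
  "l_norm p n f =
     (if p = \<infinity> then Max ((\<lambda>k. \<bar>f (cheb_node n k)\<bar>) ` {1..n})
      else ((pi / real n) * (\<Sum>k=1..n. \<bar>f (cheb_node n k)\<bar> powr (real_of_ereal p)))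
             powr (1 / real_of_ereal p))"

definition best_approx :: "nat \<Rightarrow> (real \<Rightarrow> real) \<Rightarrow> real" where
  "best_approx N f = (INF P \<in> {P :: real poly. degree P \<le> N}. sup_norm (\<lambda>x. f x - poly P x))"

end

theory Submission
  imports Defs
begin

text \<open>
  At the nodes the modified polynomials \<open>q\<^sub>r\<close> coincide with \<open>p\<^sub>r\<close>, so discrete orthogonality collapses
  the operator to \<open>S f(x) = (\<pi>/n) \<Sum>\<^sub>i f(x\<^sub>i) K(x\<^sub>i, x)\<close>. Since \<open>p\<^bsub>2n-r\<^esub> = -p\<^sub>r\<close> at the nodes, the
  kernel can be unfolded to \<open>K(x\<^sub>i, x) = \<Sum>\<^bsub>r<2n\<^esub> \<lambda>\<^sub>r p\<^sub>r(x\<^sub>i) p\<^sub>r(x)\<close> with \<open>\<lambda>\<^sub>r = g((n - r)/m)\<close>, where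
  \<open>g(u) = (1 + u)/(1 + u\<^sup>2)\<close> on \<open>[-1, 1]\<close>, continued by its boundary values 0 and 1.
  Summation by parts applied twice writes \<open>K\<close> as a combination of Fejer kernels with the second
  differences of \<open>\<lambda>\<close> as coefficients. The Fejer kernels are nonnegative, and both their integral
  against the Chebyshev weight and their mean over the nodes are known exactly, so \<open>S\<close> is dominated
  by a positive operator with constant \<open>\<Sum>\<^sub>k (k + 1) \<bar>\<Delta>\<^sup>2\<lambda>\<^sub>k\<bar> = O(n/m)\<close>; Jensen's inequality
  gives every \<open>p\<close>. The error estimate follows because \<open>S\<close> reproduces polynomials of degree at most
  \<open>n - m\<close> and has values of degree at most \<open>n + m - 1\<close>.
\<close>

section \<open>Discrete orthogonality\<close>

text \<open>Multiplying by \<open>2 * sin h\<close> with \<open>h = j * pi / (2 * n)\<close> makes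
  the sum telescope to \<open>sin (j * pi) = 0\<close>. The bounds on \<open>j\<close> put
  \<open>h\<close> strictly between 0 and \<open>pi\<close>, so \<open>sin h\<close> can be
  cancelled.\<close>

lemma sum_cos_mult_cheb_nodes:
  assumes "0 < j" "j < 2 * n"
  shows "(\<Sum>i=1..n. cos (real j * ((2 * real i - 1) * pi / (2 * real n)))) = 0"
proof -
  define h where "h = real j * pi / (2 * real n)"
  have n: "real n > 0" using assms by simp
  have "0 < h" using assms n by (simp add: h_def)
  moreover have "h < pi" using assms n by (simp add: h_def field_simps)
  ultimately have s: "sin h \<noteq> 0" using sin_gt_zero by fastforce
  have tel: "(\<Sum>i=1..N. 2 * sin h * cos ((2 * real i - 1) * h)) = sin (2 * real N * h)" for N
  proof (induction N)
    case (Suc N)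
    have "2 * sin h * cos ((2 * real (Suc N) - 1) * h)
        = sin (2 * real (Suc N) * h) - sin (2 * real N * h)"
      using sin_diff_sin[of "2 * real (Suc N) * h" "2 * real N * h"]
      by (simp add: algebra_simps add_divide_distrib diff_divide_distrib)
    with Suc show ?case by simp
  qed simp
  have "2 * sin h * (\<Sum>i=1..n. cos ((2 * real i - 1) * h)) = sin (2 * real n * h)"
    using tel[of n] by (simp add: sum_distrib_left)
  also have "2 * real n * h = real j * pi" using n by (simp add: h_def)
  finally have "(\<Sum>i=1..n. cos ((2 * real i - 1) * h)) = 0" using s by simp
  then show ?thesis by (simp add: h_def mult_ac)
qed

lemma cheb_node_angle:
  assumes "i \<in> {1..n}"
  shows "arccos (cheb_node n i) = (2 * real i - 1) * pi / (2 * real n)"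
  unfolding cheb_node_def
proof (rule arccos_cos)
  have "1 \<le> i" "i \<le> n" using assms by auto
  then have "real i \<ge> 1" "real i \<le> real n" "real n > 0" by auto
  then show "0 \<le> (2 * real i - 1) * pi / (2 * real n)"
    by (intro divide_nonneg_nonneg mult_nonneg_nonneg) auto
  have "(2 * real i - 1) * pi \<le> (2 * real n) * pi"
    using \<open>real i \<le> real n\<close> by (intro mult_right_mono) auto
  then show "(2 * real i - 1) * pi / (2 * real n) \<le> pi"
    using \<open>real n > 0\<close> by (simp add: field_simps)
qed

lemma cheb_p_cheb_node:
  assumes "i \<in> {1..n}"
  shows "cheb_p r (cheb_node n i) = (if r = 0 then sqrt (1 / pi)
    else sqrt (2 / pi) * cos (real r * ((2 * real i - 1) * pi / (2 * real n))))"
  unfolding cheb_p_def cheb_node_angle[OF assms] ..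

lemma sum_cheb_p_cheb_nodes:
  assumes "0 < j" "j < 2 * n"
  shows "(\<Sum>i=1..n. cheb_p j (cheb_node n i)) = 0"
proof -
  have "(\<Sum>i=1..n. cheb_p j (cheb_node n i))
      = sqrt (2 / pi) * (\<Sum>i=1..n. cos (real j * ((2 * real i - 1) * pi / (2 * real n))))"
    unfolding sum_distrib_left using assms(1) by (intro sum.cong) (auto simp: cheb_p_cheb_node)
  then show ?thesis using sum_cos_mult_cheb_nodes[OF assms] by simp
qed

lemma cheb_p_mult:
  assumes "0 < s" "s \<le> r"
  shows "cheb_p r x * cheb_p s x
    = (cos (real (r + s) * arccos x) + cos (real (r - s) * arccos x)) / pi"
proof -
  have "cheb_p r x * cheb_p s x
      = (sqrt (2 / pi) * sqrt (2 / pi)) * (cos (real r * arccos x) * cos (real s * arccos x))"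
    using assms by (simp only: cheb_p_def mult_ac neq0_conv[symmetric] if_False) auto
  also have "sqrt (2 / pi) * sqrt (2 / pi) = 2 / pi" by simp
  finally have "cheb_p r x * cheb_p s x
      = 2 / pi * (cos (real r * arccos x) * cos (real s * arccos x))" .
  then show ?thesis using assms
    by (simp add: cos_times_cos of_nat_diff algebra_simps add_divide_distrib)
qed

text \<open>A product of cosines is a half-sum of cosines with frequencies \<open>r + s\<close> and
  \<open>r - s\<close>, both below \<open>2 * n\<close>, so the previous cosine sums apply. Index 0
  is treated apart because \<open>cheb_p 0\<close> is normalised differently.\<close>

lemma sum_cheb_p_mult_cheb_nodes:
  assumes "r < n" "s < n"
  shows "(\<Sum>i=1..n. cheb_p r (cheb_node n i) * cheb_p s (cheb_node n i))
    = (if r = s then real n / pi else 0)"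
proof -
  \<comment> \<open>Ordering the indices first keeps the natural subtraction \<open>r - s\<close>
    faithful; symmetry gives the rest.\<close>
  have main: "(\<Sum>i=1..n. cheb_p r (cheb_node n i) * cheb_p s (cheb_node n i))
    = (if r = s then real n / pi else 0)" if "s \<le> r" "r < n" for r s
  proof (cases "s = 0")
    case True
    show ?thesis
    proof (cases "r = 0")
      case True
      then show ?thesis using \<open>s = 0\<close> by (simp add: cheb_p_def)
    next
      case False
      have "(\<Sum>i=1..n. cheb_p r (cheb_node n i) * cheb_p s (cheb_node n i))
          = (\<Sum>i=1..n. cheb_p r (cheb_node n i)) * sqrt (1 / pi)"
        using True by (simp add: sum_distrib_right cheb_p_def)
      then show ?thesis using sum_cheb_p_cheb_nodes[of r n] False that True by simp
    qed
  next
    case False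
    let ?c = "\<lambda>j. \<Sum>i=1..n. cos (real j * ((2 * real i - 1) * pi / (2 * real n)))"
    have "(\<Sum>i=1..n. cheb_p r (cheb_node n i) * cheb_p s (cheb_node n i))
        = (?c (r + s) + ?c (r - s)) / pi"
      unfolding sum.distrib[symmetric] sum_divide_distrib
      using False that by (intro sum.cong refl) (simp only: cheb_p_mult cheb_node_angle neq0_conv)
    moreover have "?c (r + s) = 0" using False that by (intro sum_cos_mult_cheb_nodes) auto
    moreover have "?c (r - s) = (if r = s then real n else 0)"
      using sum_cos_mult_cheb_nodes[of "r - s" n] that by auto
    ultimately show ?thesis by simp
  qed
  show ?thesis using main[of s r] main[of r s] assms by (cases "s \<le> r") (auto simp: mult_ac)
qed

text \<open>Aliasing: at a node with angle \<open>t\<close>, the number \<open>2 * n * t\<close> is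
  an odd multiple of \<open>pi\<close>, so reflecting the frequency about \<open>n\<close> only
  flips the sign.\<close>

lemma cheb_p_reflect_cheb_node:
  assumes "i \<in> {1..n}" "0 < r" "r < n"
  shows "cheb_p (2 * n - r) (cheb_node n i) = - cheb_p r (cheb_node n i)"
proof -
  define t where "t = (2 * real i - 1) * pi / (2 * real n)"
  have n: "real n > 0" and i: "1 \<le> i" using assms by auto
  have "real (2 * n - r) * t = (2 * real i - 1) * pi - real r * t"
    using assms n by (simp add: t_def of_nat_diff field_simps)
  moreover have "(2 * real i - 1) = real (2 * i - 1)" using i by (simp add: of_nat_diff)
  moreover have "odd (2 * i - 1)" using i by simp
  ultimately have "cos (real (2 * n - r) * t) = - cos (real r * t)"
    by (simp add: cos_diff del: of_nat_diff)
  then show ?thesis using assms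
    by (simp add: cheb_p_cheb_node t_def[symmetric] del: of_nat_diff)
qed

text \<open>This lets the middle index \<open>n\<close>, which is absent from the pairs
  \<open>r\<close>, \<open>2 * n - r\<close>, be inserted into the unfolded kernel at no
  cost.\<close>

lemma cheb_p_cheb_node_eq_0:
  assumes "i \<in> {1..n}"
  shows "cheb_p n (cheb_node n i) = 0"
proof -
  have n: "real n > 0" "n \<noteq> 0" and i: "1 \<le> i" using assms by auto
  have "real n * ((2 * real i - 1) * pi / (2 * real n)) = of_int (2 * int i - 1) * (pi / 2)"
    using n by simp
  moreover have "odd (2 * int i - 1)" by simp
  ultimately have "cos (real n * ((2 * real i - 1) * pi / (2 * real n))) = 0"
    unfolding cos_zero_iff_int by blast
  then show ?thesis using n assms by (simp add: cheb_p_cheb_node)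
qed

text \<open>By aliasing the two terms of \<open>vp_q\<close> combine into one multiple of
  \<open>cheb_p r\<close>. Its factor is 1, since the linear ramp \<open>vp_mu\<close> takes values
  adding up to 1 at \<open>r\<close> and \<open>2 * n - r\<close>.\<close>

lemma vp_q_cheb_node:
  assumes "i \<in> {1..n}" "r < n" "0 < m" "m < n"
  shows "vp_q n m r (cheb_node n i) = cheb_p r (cheb_node n i)"
proof (cases "r + m \<le> n")
  case False
  then have r: "0 < r" "\<not> 2 * n - r + m \<le> n" "2 * n - r < n + m" "r < n + m"
    using assms by auto
  have "vp_mu n m r + vp_mu n m (2 * n - r) = 1"
    using False r assms by (simp add: vp_mu_def of_nat_diff field_simps)
  moreover have "vp_q n m r (cheb_node n i)
      = (vp_mu n m r + vp_mu n m (2 * n - r)) * cheb_p r (cheb_node n i)"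
    using False cheb_p_reflect_cheb_node[OF assms(1) r(1) assms(2)]
    by (simp add: vp_q_def algebra_simps)
  ultimately show ?thesis by simp
qed (simp add: vp_q_def)

section \<open>Kernel form of the operator and reproduction of low-degree Chebyshev
  polynomials\<close>

lemma vp_nu_pos: "0 < m \<Longrightarrow> 0 < vp_nu n m r"
  by (auto simp: vp_nu_def intro!: divide_pos_pos add_pos_nonneg)

text \<open>The sum over \<open>k\<close> is a discrete inner product in the coefficients
  \<open>cheb_p r (cheb_node n k)\<close>, so only \<open>r = s\<close> survives. The two square
  roots and the factor \<open>n / pi\<close> then leave \<open>1 / vp_nu n m r\<close>.\<close>

lemma sum_vp_phi_mult:
  assumes "i \<in> {1..n}" "0 < m" "m < n"
  shows "(\<Sum>k=1..n. vp_phi n m k (cheb_node n i) * vp_phi n m k x)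
    = (\<Sum>r<n. cheb_p r (cheb_node n i) * vp_q n m r x / vp_nu n m r)"
proof -
  let ?a = "\<lambda>r. sqrt (pi / (real n * vp_nu n m r))"
  let ?P = "\<lambda>r k. cheb_p r (cheb_node n k)"
  have n: "real n > 0" using assms by simp
  have aa: "?a r * ?a r = pi / (real n * vp_nu n m r)" for r
    using n vp_nu_pos[OF assms(2), of n r] by simp
  have "(\<Sum>k=1..n. vp_phi n m k (cheb_node n i) * vp_phi n m k x)
      = (\<Sum>k=1..n. \<Sum>r<n. \<Sum>s<n. ?a r * ?a s * ?P r i * vp_q n m s x * (?P r k * ?P s k))"
    unfolding vp_phi_def sum_product using assms
    by (intro sum.cong refl) (simp add: vp_q_cheb_node mult_ac)
  also have "\<dots> = (\<Sum>r<n. \<Sum>s<n. ?a r * ?a s * ?P r i * vp_q n m s x * (\<Sum>k=1..n. ?P r k * ?P s k))"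
    unfolding sum_distrib_left
    by (subst sum.swap, rule sum.cong[OF refl], rule sum.swap)
  also have "\<dots> = (\<Sum>r<n. \<Sum>s<n. if r = s then ?a r * ?a s * ?P r i * vp_q n m s x * (real n / pi) else 0)"
    by (intro sum.cong refl) (simp only: sum_cheb_p_mult_cheb_nodes lessThan_iff, simp)
  also have "\<dots> = (\<Sum>r<n. (?a r * ?a r) * ?P r i * vp_q n m r x * (real n / pi))"
    by simp
  also have "\<dots> = (\<Sum>r<n. ?P r i * vp_q n m r x / vp_nu n m r)"
    unfolding aa using n by (intro sum.cong refl) simp
  finally show ?thesis .
qed

lemma vp_S_eq_kernel_sum:
  assumes "0 < m" "m < n"
  shows "vp_S n m f x = pi / real n * (\<Sum>i=1..n. f (cheb_node n i) *
    (\<Sum>r<n. cheb_p r (cheb_node n i) * vp_q n m r x / vp_nu n m r))"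
proof -
  have "vp_S n m f x = (\<Sum>k=1..n. \<Sum>i=1..n. pi / real n * (f (cheb_node n i) *
      (vp_phi n m k (cheb_node n i) * vp_phi n m k x)))"
    unfolding vp_S_def sum_distrib_left sum_distrib_right by (simp add: mult_ac)
  also have "\<dots> = pi / real n * (\<Sum>i=1..n. f (cheb_node n i) *
      (\<Sum>k=1..n. vp_phi n m k (cheb_node n i) * vp_phi n m k x))"
    unfolding sum_distrib_left by (rule sum.swap)
  also have "\<dots> = pi / real n * (\<Sum>i=1..n. f (cheb_node n i) *
      (\<Sum>r<n. cheb_p r (cheb_node n i) * vp_q n m r x / vp_nu n m r))"
    by (intro arg_cong[where f="\<lambda>z. pi / real n * z"] sum.cong refl)
      (simp only: sum_vp_phi_mult[OF _ assms])
  finally show ?thesis .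
qed

text \<open>Discrete orthogonality selects the single index \<open>s\<close>, which lies in the flat
  range where \<open>vp_q\<close> is \<open>cheb_p\<close> and \<open>vp_nu\<close> is 1.\<close>

lemma vp_S_cheb_p:
  assumes "0 < m" "m < n" "s \<le> n - m"
  shows "vp_S n m (cheb_p s) x = cheb_p s x"
proof -
  have s: "s < n" "s + m \<le> n" using assms by auto
  have "vp_S n m (cheb_p s) x = pi / real n * (\<Sum>i=1..n. \<Sum>r<n. vp_q n m r x / vp_nu n m r *
      (cheb_p r (cheb_node n i) * cheb_p s (cheb_node n i)))"
    unfolding vp_S_eq_kernel_sum[OF assms(1,2)] sum_distrib_left by (simp add: mult_ac)
  also have "\<dots> = pi / real n * (\<Sum>r<n. vp_q n m r x / vp_nu n m r *
      (\<Sum>i=1..n. cheb_p r (cheb_node n i) * cheb_p s (cheb_node n i)))"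
    by (subst sum.swap) (simp only: sum_distrib_left)
  also have "\<dots> = pi / real n * (\<Sum>r<n. if r = s then vp_q n m r x / vp_nu n m r * (real n / pi) else 0)"
    using s by (intro arg_cong[where f="\<lambda>z. pi / real n * z"] sum.cong refl)
      (simp only: sum_cheb_p_mult_cheb_nodes lessThan_iff, simp)
  also have "\<dots> = cheb_p s x" using s by (simp add: vp_q_def vp_nu_def)
  finally show ?thesis .
qed

section \<open>The unfolded kernel\<close>

text \<open>With \<open>u = (n - r) / m\<close> in the transition range, \<open>vp_mu\<close> is
  \<open>(1 + u) / 2\<close> and \<open>vp_nu\<close> is \<open>(1 + u\<^sup>2) / 2\<close>; the
  ramp is their quotient. Replacing \<open>r\<close> by \<open>2 * n - r\<close> changes
  \<open>u\<close> to \<open>- u\<close> and keeps the denominator.\<close>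

definition vp_ramp :: "real \<Rightarrow> real" where
  "vp_ramp u = (1 + u) / (1 + u\<^sup>2)"

text \<open>Clamping the argument produces both flat parts without a case distinction, because the
  ramp is 1 at 1 and 0 at -1.\<close>

definition vp_lam :: "nat \<Rightarrow> nat \<Rightarrow> nat \<Rightarrow> real" where
  "vp_lam n m r = vp_ramp (max (-1) (min 1 ((real n - real r) / real m)))"

definition second_diff :: "(nat \<Rightarrow> real) \<Rightarrow> nat \<Rightarrow> real" where
  "second_diff a k = a k - 2 * a (Suc k) + a (Suc (Suc k))"

text \<open>
  Writing the ramp through \<open>1/(u + \<i>)\<close>, whose modulus is at most 1, makes both difference
  estimates below immediate.
\<close>
lemma vp_ramp_eq_Re: "vp_ramp u = Re ((1 + \<i>) / (of_real u + \<i>))"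
  by (simp add: vp_ramp_def Re_divide power2_eq_square add_ac)

lemma of_real_plus_i_nonzero: "of_real u + \<i> \<noteq> 0"
  by (simp add: complex_eq_iff)

lemma norm_of_real_plus_i_ge_1: "1 \<le> cmod (of_real u + \<i>)"
  by (simp add: cmod_def)

lemma norm_one_plus_i_le_2: "cmod (1 + \<i>) \<le> 2"
  using norm_triangle_ineq[of 1 \<i>] by simp

text \<open>Resolvent identity \<open>1/z - 1/w = (w - z)/(z w)\<close> with both denominators of
  modulus at least 1. The constant 2 is the bound for the modulus of
  \<open>1 + \<i>\<close>.\<close>

lemma vp_ramp_lipschitz: "\<bar>vp_ramp u - vp_ramp v\<bar> \<le> 2 * \<bar>u - v\<bar>"
proof -
  let ?z = "complex_of_real u + \<i>" and ?w = "complex_of_real v + \<i>"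
  have "(1 + \<i>) / ?z - (1 + \<i>) / ?w = (1 + \<i>) * of_real (v - u) / (?z * ?w)"
    using of_real_plus_i_nonzero[of u] of_real_plus_i_nonzero[of v]
    by (simp add: divide_simps) (simp add: algebra_simps)
  then have "vp_ramp u - vp_ramp v = Re ((1 + \<i>) * of_real (v - u) / (?z * ?w))"
    unfolding vp_ramp_eq_Re minus_complex.sel(1)[symmetric] by (simp only:)
  then have "\<bar>vp_ramp u - vp_ramp v\<bar> \<le> cmod ((1 + \<i>) * of_real (v - u) / (?z * ?w))"
    using abs_Re_le_cmod by (simp only:)
  also have "\<dots> = cmod (1 + \<i>) * \<bar>v - u\<bar> / (cmod ?z * cmod ?w)"
    by (simp only: norm_mult norm_divide norm_of_real)
  also have "\<dots> \<le> (2 * \<bar>v - u\<bar>) / (1 * 1)"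
    using norm_of_real_plus_i_ge_1 norm_one_plus_i_le_2
    by (intro frac_le mult_mono mult_nonneg_nonneg) auto
  finally show ?thesis by (simp add: abs_minus_commute)
qed

text \<open>The second difference of \<open>1/z\<close> with step \<open>h\<close> is exactly
  \<open>2 h\<^sup>2 / ((z + h) z (z - h))\<close>; the constant 4 is this 2 times the bound for the
  modulus of \<open>1 + \<i>\<close>.\<close>

lemma vp_ramp_second_diff: "\<bar>vp_ramp (u + d) - 2 * vp_ramp u + vp_ramp (u - d)\<bar> \<le> 4 * d\<^sup>2"
proof -
  let ?z = "complex_of_real u + \<i>"
  let ?a = "complex_of_real (u + d) + \<i>" and ?b = "complex_of_real (u - d) + \<i>"
  have e: "1 / (z + h) - 2 / z + 1 / (z - h) = 2 * h\<^sup>2 / ((z + h) * z * (z - h))"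
    if "z \<noteq> 0" "z + h \<noteq> 0" "z - h \<noteq> 0" for z h :: complex
  proof -
    \<comment> \<open>Replacing \<open>z + h\<close> and \<open>z - h\<close> by independent
      variables lets the simplifier treat them as atoms when passing to the common
      denominator.\<close>
    have opaque: "1 / k = z * l / (k * z * l)" "2 / z = 2 * k * l / (k * z * l)" "1 / l = k * z / (k * z * l)"
      if "z \<noteq> 0" "k \<noteq> 0" "l \<noteq> 0" for z k l :: complex using that by simp_all
    have "1 / (z + h) = z * (z - h) / ((z + h) * z * (z - h))"
      "2 / z = 2 * (z + h) * (z - h) / ((z + h) * z * (z - h))"
      "1 / (z - h) = (z + h) * z / ((z + h) * z * (z - h))"
      using that by - (rule opaque; assumption)+
    then have "1 / (z + h) - 2 / z + 1 / (z - h)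
        = (z * (z - h) - 2 * (z + h) * (z - h) + (z + h) * z) / ((z + h) * z * (z - h))"
      by (simp only: diff_divide_distrib add_divide_distrib)
    also have "z * (z - h) - 2 * (z + h) * (z - h) + (z + h) * z = 2 * h\<^sup>2"
      by (simp add: algebra_simps power2_eq_square)
    finally show ?thesis .
  qed
  have ab: "?a = ?z + of_real d" "?b = ?z - of_real d" by (simp_all add: algebra_simps)
  have "1 / ?a - 2 / ?z + 1 / ?b = 2 * (of_real d)\<^sup>2 / (?a * ?z * ?b)"
    using of_real_plus_i_nonzero[of u] of_real_plus_i_nonzero[of "u + d"]
      of_real_plus_i_nonzero[of "u - d"] unfolding ab by (rule e)
  moreover have "w / a - 2 * (w / z) + w / b = w * (1 / a - 2 / z + 1 / b)" for w a z b :: complex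
    by (simp add: algebra_simps)
  ultimately have "(1 + \<i>) / ?a - 2 * ((1 + \<i>) / ?z) + (1 + \<i>) / ?b
      = (1 + \<i>) * (2 * (of_real d)\<^sup>2 / (?a * ?z * ?b))"
    by (simp only:)
  moreover have "vp_ramp (u + d) - 2 * vp_ramp u + vp_ramp (u - d)
      = Re ((1 + \<i>) / ?a - 2 * ((1 + \<i>) / ?z) + (1 + \<i>) / ?b)"
  proof -
    have "Re (a - 2 * b + c) = Re a - 2 * Re b + Re c" for a b c by simp
    then show ?thesis unfolding vp_ramp_eq_Re by (simp only:)
  qed
  ultimately have "vp_ramp (u + d) - 2 * vp_ramp u + vp_ramp (u - d)
      = Re ((1 + \<i>) * (2 * (of_real d)\<^sup>2 / (?a * ?z * ?b)))" by (simp only:)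
  then have "\<bar>vp_ramp (u + d) - 2 * vp_ramp u + vp_ramp (u - d)\<bar>
      \<le> cmod ((1 + \<i>) * (2 * (of_real d)\<^sup>2 / (?a * ?z * ?b)))"
    using abs_Re_le_cmod by (simp only:)
  also have "\<dots> = cmod (1 + \<i>) * (2 * d\<^sup>2 / (cmod ?a * cmod ?z * cmod ?b))"
    by (simp only: norm_mult norm_divide norm_of_real norm_power norm_numeral power2_abs)
  also have "\<dots> \<le> 2 * (2 * d\<^sup>2 / (1 * 1 * 1))"
    using norm_of_real_plus_i_ge_1 norm_one_plus_i_le_2
    by (intro mult_mono frac_le mult_nonneg_nonneg divide_nonneg_nonneg)
      (auto simp del: of_real_add of_real_diff)
  finally show ?thesis by simp
qed

lemma vp_lam_eq_1: "0 < m \<Longrightarrow> r + m \<le> n \<Longrightarrow> vp_lam n m r = 1"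
proof -
  assume "0 < m" "r + m \<le> n"
  then have "(real n - real r) / real m \<ge> 1" by (simp add: field_simps)
  then show ?thesis by (simp add: vp_lam_def vp_ramp_def)
qed

lemma vp_lam_eq_0: "0 < m \<Longrightarrow> n + m \<le> r \<Longrightarrow> vp_lam n m r = 0"
proof -
  assume "0 < m" "n + m \<le> r"
  then have "(real n - real r) / real m \<le> -1" by (simp add: field_simps)
  then show ?thesis by (simp add: vp_lam_def vp_ramp_def)
qed

lemma vp_lam_eq_ramp:
  assumes "0 < m" "n \<le> r + m" "r \<le> n + m"
  shows "vp_lam n m r = vp_ramp ((real n - real r) / real m)"
proof -
  have "(real n - real r) / real m \<le> 1" "-1 \<le> (real n - real r) / real m"
    using assms by (simp_all add: field_simps)
  then show ?thesis by (simp add: vp_lam_def)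
qed

text \<open>Clamping does not increase distances, consecutive arguments are \<open>1 / m\<close>
  apart, and the ramp has Lipschitz constant 2.\<close>

lemma vp_lam_diff:
  assumes "0 < m"
  shows "\<bar>vp_lam n m r - vp_lam n m (Suc r)\<bar> \<le> 2 / real m"
proof -
  let ?c = "\<lambda>r. max (-1) (min 1 ((real n - real r) / real m))"
  have "\<bar>?c r - ?c (Suc r)\<bar> \<le> \<bar>(real n - real r) / real m - (real n - real (Suc r)) / real m\<bar>"
    (is "_ \<le> \<bar>?a - ?b\<bar>")
  proof -
    have "\<bar>max (-1) (min 1 a) - max (-1) (min 1 b)\<bar> \<le> \<bar>a - b\<bar>" for a b :: real
      by (auto simp: max_def min_def abs_if)
    then show ?thesis .
  qed
  also have "?a - ?b = 1 / real m" by (simp flip: diff_divide_distrib)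
  also have "\<bar>\<dots>\<bar> = 1 / real m" by simp
  finally have "2 * \<bar>?c r - ?c (Suc r)\<bar> \<le> 2 / real m" by simp
  then show ?thesis unfolding vp_lam_def by (rule order_trans[OF vp_ramp_lipschitz])
qed

text \<open>The two isolated terms come from the kinks of \<open>\<lambda>\<close> at \<open>r = n - m\<close> and \<open>r = n + m\<close>.\<close>
lemma second_diff_vp_lam_bound:
  assumes "0 < m" "m < n"
  shows "\<bar>second_diff (vp_lam n m) k\<bar> \<le> (if k \<in> {n - m - 1..<n + m} then 4 / (real m)\<^sup>2 else 0)
    + (if k = n - m - 1 then 4 / real m else 0) + (if k = n + m - 1 then 4 / real m else 0)"
proof -
  have cases: "k + 2 + m \<le> n \<or> n + m \<le> k \<or> Suc k + m = n \<or> Suc k = n + m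
      \<or> n \<le> k + m \<and> Suc k < n + m" by arith
  consider "k + 2 + m \<le> n" | "n + m \<le> k" | "k = n - m - 1" | "k = n + m - 1"
    | "n \<le> k + m" "Suc k < n + m" using cases by fastforce
  then show ?thesis
  proof cases
    case 1
    then show ?thesis using assms by (simp add: second_diff_def vp_lam_eq_1)
  next
    case 2
    then show ?thesis using assms by (simp add: second_diff_def vp_lam_eq_0)
  next
    case 5
    \<comment> \<open>The difference is indexed by its left end but centred at \<open>Suc k\<close>;
      in this case all three indices lie on the ramp, where the step is
      \<open>1 / m\<close>.\<close>
    have "(real n - real k) / real m = (real n - real (Suc k)) / real m + 1 / real m"
      "(real n - real (Suc (Suc k))) / real m = (real n - real (Suc k)) / real m - 1 / real m"
      using assms by (simp_all add: field_simps)
    then have "second_diff (vp_lam n m) k = vp_ramp ((real n - real (Suc k)) / real m + 1 / real m)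
       - 2 * vp_ramp ((real n - real (Suc k)) / real m) + vp_ramp ((real n - real (Suc k)) / real m - 1 / real m)"
      using 5 assms by (simp only: second_diff_def vp_lam_eq_ramp)
    then have "\<bar>second_diff (vp_lam n m) k\<bar> \<le> 4 / (real m)\<^sup>2"
      using vp_ramp_second_diff[of "(real n - real (Suc k)) / real m" "1 / real m"]
      by (simp add: power_divide)
    moreover have "k \<in> {n - m - 1..<n + m}" "k \<noteq> n - m - 1" "k \<noteq> n + m - 1" using 5 assms by auto
    ultimately show ?thesis by (simp only: if_True if_False)
  next
    case 3
    \<comment> \<open>Across a kink only the first-difference bound is available; two of them give
      \<open>2 / m + 2 / m\<close>.\<close>
    have "\<bar>second_diff (vp_lam n m) k\<bar> \<le> 4 / real m"
      using vp_lam_diff[OF assms(1), of n k] vp_lam_diff[OF assms(1), of n "Suc k"]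
      unfolding second_diff_def by linarith
    moreover have "0 \<le> 4 / (real m)\<^sup>2" "0 \<le> 4 / real m" by simp_all
    ultimately show ?thesis unfolding if_P[OF 3] by (auto simp only: split: if_split)
  next
    case 4
    have "\<bar>second_diff (vp_lam n m) k\<bar> \<le> 4 / real m"
      using vp_lam_diff[OF assms(1), of n k] vp_lam_diff[OF assms(1), of n "Suc k"]
      unfolding second_diff_def by linarith
    moreover have "0 \<le> 4 / (real m)\<^sup>2" "0 \<le> 4 / real m" by simp_all
    ultimately show ?thesis unfolding if_P[OF 4] by (auto simp only: split: if_split)
  qed
qed

text \<open>The ramp range has \<open>2 * m + 1\<close>, hence at most \<open>3 * m\<close>, indices
  and contributes \<open>12 / m\<close>; the kinks add \<open>8 / m\<close>. Bounding every weight
  \<open>Suc k\<close> by \<open>2 * n\<close> turns \<open>20 / m\<close> into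
  \<open>40 * n / m\<close>.\<close>

lemma sum_second_diff_vp_lam_le:
  assumes "0 < m" "m < n"
  shows "(\<Sum>k<2*n. \<bar>second_diff (vp_lam n m) k\<bar> * real (Suc k)) \<le> 40 * real n / real m"
proof -
  have m: "real m \<ge> 1" using assms by simp
  let ?I = "{n - m - 1..<n + m}"
  have sub: "?I \<subseteq> {..<2*n}" using assms by auto
  have card: "real (card ?I) \<le> 3 * real m" using assms by (simp add: of_nat_diff)
  have "(\<Sum>k<2*n. \<bar>second_diff (vp_lam n m) k\<bar>)
      \<le> (\<Sum>k<2*n. (if k \<in> ?I then 4 / (real m)\<^sup>2 else 0)
        + (if k = n - m - 1 then 4 / real m else 0) + (if k = n + m - 1 then 4 / real m else 0))"
    by (intro sum_mono second_diff_vp_lam_bound assms)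
  also have "\<dots> = (\<Sum>k<2*n. if k \<in> ?I then 4 / (real m)\<^sup>2 else 0) + 4 / real m + 4 / real m"
    unfolding sum.distrib using assms by auto
  also have "(\<Sum>k<2*n. if k \<in> ?I then 4 / (real m)\<^sup>2 else 0) = real (card ?I) * (4 / (real m)\<^sup>2)"
    using sub by (subst sum.inter_restrict[symmetric]) (auto simp: Int_absorb1)
  also have "\<dots> \<le> 3 * real m * (4 / (real m)\<^sup>2)"
    by (intro mult_right_mono card) simp
  also have "\<dots> = 12 / real m" using m by (simp add: power2_eq_square)
  finally have *: "(\<Sum>k<2*n. \<bar>second_diff (vp_lam n m) k\<bar>) \<le> 20 / real m" by simp
  have "(\<Sum>k<2*n. \<bar>second_diff (vp_lam n m) k\<bar> * real (Suc k))
      \<le> (\<Sum>k<2*n. \<bar>second_diff (vp_lam n m) k\<bar> * (2 * real n))"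
    by (intro sum_mono mult_left_mono) auto
  also have "\<dots> \<le> 20 / real m * (2 * real n)"
    unfolding sum_distrib_right[symmetric] by (intro mult_right_mono *) simp
  finally show ?thesis by simp
qed

text \<open>For \<open>0 < r < n\<close> each term splits into contributions at \<open>r\<close> and
  \<open>2 * n - r\<close>, the sign of the second being absorbed by aliasing. Index 0 has no mirror
  image below \<open>2 * n\<close>, and index \<open>n\<close> contributes 0.\<close>

lemma vp_kernel_eq_vp_lam_sum:
  assumes "i \<in> {1..n}" "0 < m" "m < n"
  shows "(\<Sum>r<n. cheb_p r (cheb_node n i) * vp_q n m r x / vp_nu n m r)
    = (\<Sum>r<2*n. vp_lam n m r * (cheb_p r (cheb_node n i) * cheb_p r x))"
proof -
  let ?L = "\<lambda>r. cheb_p r (cheb_node n i) * vp_q n m r x / vp_nu n m r"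
  let ?R = "\<lambda>r. vp_lam n m r * (cheb_p r (cheb_node n i) * cheb_p r x)"
  have 1: "?L r = ?R r + ?R (2 * n - r)" if r: "0 < r" "r < n" for r
  proof -
    note refl = cheb_p_reflect_cheb_node[OF assms(1) r]
    show ?thesis
    proof (cases "r + m \<le> n")
      case True
      then show ?thesis using assms
        by (simp add: vp_lam_eq_1 vp_lam_eq_0 vp_q_def vp_nu_def)
    next
      case False
      define u where "u = (real n - real r) / real m"
      have m: "real m > 0" and nr: "real n - real r = u * real m" using assms by (auto simp: u_def)
      have "vp_lam n m r = vp_ramp u" using False assms r by (simp add: vp_lam_eq_ramp u_def)
      moreover have "vp_lam n m (2 * n - r) = vp_ramp (- u)"
        using False assms r by (simp add: vp_lam_eq_ramp u_def of_nat_diff minus_divide_left)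
      moreover have "vp_mu n m r = (1 + u) / 2"
        using False r m by (simp add: vp_mu_def u_def field_simps)
      moreover have "vp_mu n m (2 * n - r) = (1 - u) / 2"
        using False r m by (auto simp: vp_mu_def u_def field_simps of_nat_diff)
      moreover have "vp_nu n m r = (1 + u\<^sup>2) / 2"
        using False r m unfolding vp_nu_def nr by (simp add: power_mult_distrib field_simps)
      moreover have "1 + u\<^sup>2 > 0" by (simp add: add_pos_nonneg)
      ultimately have "vp_mu n m r / vp_nu n m r = vp_lam n m r"
        "vp_mu n m (2 * n - r) / vp_nu n m r = vp_lam n m (2 * n - r)"
        by (simp_all only: vp_ramp_def) (simp_all add: divide_simps, simp_all add: algebra_simps)
      moreover have "a * (c * p - d * q) / e = c / e * (a * p) + d / e * (- a * q)"
        for a c p d q e :: real by (simp add: algebra_simps diff_divide_distrib)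
      ultimately show ?thesis using False unfolding vp_q_def refl by (simp only: if_False)
    qed
  qed
  have 0: "?L 0 = ?R 0" using assms by (simp add: vp_lam_eq_1 vp_q_def vp_nu_def)
  have n: "?R n = 0" using cheb_p_cheb_node_eq_0[OF assms(1)] by simp
  have s0: "{..<n} = insert 0 {1..<n}" using assms by auto
  have s1: "{..<2*n} = insert 0 (insert n ({1..<n} \<union> {n+1..<2*n}))" using assms by auto
  have "sum ?L {..<n} = ?R 0 + (\<Sum>r\<in>{1..<n}. ?R r + ?R (2 * n - r))"
    unfolding s0 using 0 1 by simp
  also have "\<dots> = ?R 0 + ((\<Sum>r\<in>{1..<n}. ?R r) + (\<Sum>r\<in>{1..<n}. ?R (2 * n - r)))"
    by (simp only: sum.distrib)
  also have "(\<Sum>r\<in>{1..<n}. ?R (2 * n - r)) = (\<Sum>r\<in>{n+1..<2*n}. ?R r)"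
    by (rule sum.reindex_bij_witness[of _ "\<lambda>r. 2 * n - r" "\<lambda>r. 2 * n - r"]) auto
  also have "?R 0 + ((\<Sum>r\<in>{1..<n}. ?R r) + (\<Sum>r\<in>{n+1..<2*n}. ?R r)) = sum ?R {..<2*n}"
  proof -
    have "sum ?R ({1..<n} \<union> {n+1..<2*n}) = (\<Sum>r\<in>{1..<n}. ?R r) + (\<Sum>r\<in>{n+1..<2*n}. ?R r)"
      by (rule sum.union_disjoint) auto
    moreover have "sum ?R {..<2*n} = ?R 0 + (?R n + sum ?R ({1..<n} \<union> {n+1..<2*n}))"
      unfolding s1 using assms by (subst sum.insert; simp)+
    ultimately show ?thesis unfolding n by simp
  qed
  finally show ?thesis .
qed

section \<open>Fejer kernels\<close>

lemma sum_by_parts: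
  fixes a e :: "nat \<Rightarrow> real"
  shows "(\<Sum>j<N. a j * e j) = (\<Sum>l<N. (a l - a (Suc l)) * (\<Sum>j\<le>l. e j)) + a N * (\<Sum>j<N. e j)"
proof (induction N)
  case (Suc N)
  have "(\<Sum>j\<le>N. e j) = (\<Sum>j<N. e j) + e N" by (simp add: lessThan_Suc_atMost[symmetric])
  then show ?case using Suc by (simp add: algebra_simps)
qed simp

text \<open>The two Abel summations leave boundary coefficients \<open>a N\<close> and
  \<open>a N - a (Suc N)\<close>, which is why two consecutive zeros are assumed.\<close>

lemma sum_by_parts_twice:
  fixes a e :: "nat \<Rightarrow> real"
  assumes "a N = 0" "a (Suc N) = 0"
  shows "(\<Sum>j<N. a j * e j) = (\<Sum>k<N. second_diff a k * (\<Sum>l\<le>k. \<Sum>j\<le>l. e j))"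
proof -
  have "(\<Sum>j<N. a j * e j) = (\<Sum>l<N. (a l - a (Suc l)) * (\<Sum>j\<le>l. e j))"
    using assms by (subst sum_by_parts) simp
  also have "\<dots> = (\<Sum>k<N. (a k - a (Suc k) - (a (Suc k) - a (Suc (Suc k)))) * (\<Sum>l\<le>k. \<Sum>j\<le>l. e j))"
    using assms by (subst sum_by_parts) simp
  finally show ?thesis by (simp add: second_diff_def algebra_simps)
qed

text \<open>Unnormalised: \<open>k + 1\<close> times the usual Fejer mean.\<close>
definition cheb_fejer :: "nat \<Rightarrow> real \<Rightarrow> real \<Rightarrow> real" where
  "cheb_fejer k y x = (\<Sum>l\<le>k. \<Sum>j\<le>l. cheb_p j y * cheb_p j x)"

text \<open>The right side is the squared modulus of the sum of \<open>exp (\<i> j t)\<close> over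
  \<open>j \<le> k\<close>, which makes the left side visibly nonnegative. In the induction step the
  cross terms are the cosines of \<open>(Suc k - j) * t\<close>, the new Dirichlet sum in reverse
  order.\<close>

lemma fejer_sum_eq_squares:
  "2 * (\<Sum>l\<le>k. \<Sum>j\<le>l. (if j = 0 then 1 / 2 else cos (real j * t)))
    = (\<Sum>j\<le>k. cos (real j * t))\<^sup>2 + (\<Sum>j\<le>k. sin (real j * t))\<^sup>2"
proof (induction k)
  case (Suc k)
  let ?C = "\<Sum>j\<le>k. cos (real j * t)" and ?S = "\<Sum>j\<le>k. sin (real j * t)"
  let ?c = "cos (real (Suc k) * t)" and ?s = "sin (real (Suc k) * t)"
  have "?C * ?c + ?S * ?s = (\<Sum>j\<le>k. cos (real (Suc k - j) * t))"
    unfolding sum_distrib_right sum.distrib[symmetric]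
  proof (intro sum.cong refl)
    fix j assume "j \<in> {..k}"
    then have "real (Suc k - j) * t = real (Suc k) * t - real j * t"
      by (simp add: of_nat_diff algebra_simps)
    then show "cos (real j * t) * ?c + sin (real j * t) * ?s = cos (real (Suc k - j) * t)"
      by (simp add: cos_diff)
  qed
  also have "\<dots> = (\<Sum>j\<in>{1..Suc k}. cos (real j * t))"
    by (rule sum.reindex_bij_witness[of _ "\<lambda>j. Suc k - j" "\<lambda>j. Suc k - j"]) auto
  finally have *: "?C * ?c + ?S * ?s = (\<Sum>j\<in>{1..Suc k}. cos (real j * t))" .
  have s: "{..Suc k} = insert 0 {1..Suc k}" by auto
  have "(\<Sum>j\<le>Suc k. (if j = 0 then 1 / 2 else cos (real j * t))) = 1 / 2 + (\<Sum>j\<in>{1..Suc k}. cos (real j * t))"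
    unfolding s by (subst sum.insert) (auto intro: sum.cong)
  then have "2 * (\<Sum>l\<le>Suc k. \<Sum>j\<le>l. (if j = 0 then 1 / 2 else cos (real j * t)))
      = ?C\<^sup>2 + ?S\<^sup>2 + (1 + 2 * (?C * ?c + ?S * ?s))"
    unfolding * Suc.IH[symmetric] by (simp add: algebra_simps)
  also have "1 + 2 * (?C * ?c + ?S * ?s) = ?c\<^sup>2 + ?s\<^sup>2 + 2 * (?C * ?c + ?S * ?s)" by simp
  also have "?C\<^sup>2 + ?S\<^sup>2 + (?c\<^sup>2 + ?s\<^sup>2 + 2 * (?C * ?c + ?S * ?s)) = (?C + ?c)\<^sup>2 + (?S + ?s)\<^sup>2"
    by (simp add: power2_sum algebra_simps)
  finally show ?case by (simp only: sum.atMost_Suc)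
qed simp

text \<open>Product-to-sum splits the kernel into two Fejer sums at the angles \<open>t - s\<close>
  and \<open>t + s\<close>. The weight \<open>1 / 2\<close> at index 0 matches the smaller
  normalisation of \<open>cheb_p 0\<close>.\<close>

lemma cheb_fejer_nonneg: "0 \<le> cheb_fejer k y x"
proof -
  define s t where "s = arccos y" and "t = arccos x"
  let ?c = "\<lambda>u j. if j = 0 then 1 / 2 else cos (real j * u)"
  have "cheb_p j y * cheb_p j x = (?c (t - s) j + ?c (t + s) j) / pi" for j
  proof (cases "j = 0")
    case False
    have "cheb_p j y * cheb_p j x
        = (sqrt (2 / pi) * sqrt (2 / pi)) * (cos (real j * t) * cos (real j * s))"
      using False by (simp only: cheb_p_def s_def t_def if_False mult_ac)
    also have "sqrt (2 / pi) * sqrt (2 / pi) = 2 / pi" by simp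
    finally show ?thesis using False by (simp add: cos_times_cos ring_distribs add_divide_distrib)
  qed (simp add: cheb_p_def)
  then have "cheb_fejer k y x
      = ((\<Sum>l\<le>k. \<Sum>j\<le>l. ?c (t - s) j) + (\<Sum>l\<le>k. \<Sum>j\<le>l. ?c (t + s) j)) / pi"
    unfolding cheb_fejer_def by (simp only: sum.distrib sum_divide_distrib[symmetric])
  moreover have "0 \<le> (\<Sum>l\<le>k. \<Sum>j\<le>l. ?c u j)" for u
  proof -
    have "0 \<le> 2 * (\<Sum>l\<le>k. \<Sum>j\<le>l. ?c u j)" unfolding fejer_sum_eq_squares by simp
    then show ?thesis by simp
  qed
  ultimately show ?thesis by (simp only: pi_ge_zero divide_nonneg_nonneg add_nonneg_nonneg)
qed

text \<open>Every positive frequency up to \<open>k < 2 * n\<close> sums to zero over the nodes; the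
  constant term remains, once for each of the \<open>Suc k\<close> values of
  \<open>l\<close>.\<close>

lemma sum_cheb_fejer_cheb_nodes:
  assumes "k < 2 * n"
  shows "pi / real n * (\<Sum>i=1..n. cheb_fejer k (cheb_node n i) x) = real (Suc k)"
proof -
  have n: "n > 0" using assms by simp
  have *: "(\<Sum>i=1..n. cheb_p j (cheb_node n i)) = (if j = 0 then real n * sqrt (1 / pi) else 0)"
    if "j < 2 * n" for j
    using sum_cheb_p_cheb_nodes[of j n] that by (auto simp: cheb_p_def)
  have "(\<Sum>i=1..n. cheb_fejer k (cheb_node n i) x)
      = (\<Sum>l\<le>k. \<Sum>j\<le>l. (\<Sum>i=1..n. cheb_p j (cheb_node n i)) * cheb_p j x)"
    unfolding cheb_fejer_def sum_distrib_right
    by (subst sum.swap, rule sum.cong[OF refl], rule sum.swap)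
  also have "\<dots> = (\<Sum>l\<le>k. \<Sum>j\<le>l. if j = 0 then real n / pi else 0)"
  proof (intro sum.cong refl)
    fix l j assume "l \<in> {..k}" "j \<in> {..l}"
    then have "j < 2 * n" using assms by auto
    then show "(\<Sum>i=1..n. cheb_p j (cheb_node n i)) * cheb_p j x = (if j = 0 then real n / pi else 0)"
      unfolding *[OF \<open>j < 2 * n\<close>] by (simp add: cheb_p_def mult.assoc)
  qed
  also have "\<dots> = real (Suc k) * (real n / pi)" by simp
  finally show ?thesis using n by simp
qed

section \<open>Boundedness\<close>

text \<open>Convexity of the power function, as its tangent inequality at \<open>Y\<close>. It is
  Young's inequality with weights \<open>1 / p\<close> and \<open>1 - 1 / p\<close>, multiplied by
  \<open>p\<close>.\<close>

lemma powr_above_tangent: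
  fixes y Y p :: real
  assumes "0 \<le> y" "0 < Y" "1 \<le> p"
  shows "p * y * Y powr (p - 1) \<le> y powr p + (p - 1) * Y powr p"
proof (cases "y = 0")
  case False
  have "(y powr p) powr (1 / p) * (Y powr p) powr (1 - 1 / p)
      \<le> 1 / p * y powr p + (1 - 1 / p) * Y powr p"
    using assms False by (intro Youngs_inequality_0) auto
  moreover have "p * (1 - 1 / p) = p - 1" using assms by (simp add: field_simps)
  ultimately have "y * Y powr (p - 1) \<le> 1 / p * y powr p + (1 - 1 / p) * Y powr p"
    using assms by (simp add: powr_powr)
  then have "p * (y * Y powr (p - 1)) \<le> p * (1 / p * y powr p + (1 - 1 / p) * Y powr p)"
    using assms by (intro mult_left_mono) auto
  also have "\<dots> = y powr p + (p - 1) * Y powr p"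
    using assms by (simp add: field_simps)
  finally show ?thesis by (simp add: mult.assoc)
qed (use assms in auto)

text \<open>Jensen's inequality for weights of total mass \<open>A\<close>: sum the tangent
  inequalities taken at the weighted mean \<open>Y\<close>. Undoing the normalisation of the weights
  costs the factor \<open>A powr (p - 1)\<close>.\<close>

lemma powr_weighted_sum_le:
  fixes a y :: "'a \<Rightarrow> real"
  assumes a: "\<And>i. i \<in> S \<Longrightarrow> 0 \<le> a i" and y: "\<And>i. i \<in> S \<Longrightarrow> 0 \<le> y i" and p: "1 \<le> p"
    and A: "(\<Sum>i\<in>S. a i) = A"
  shows "(\<Sum>i\<in>S. a i * y i) powr p \<le> A powr (p - 1) * (\<Sum>i\<in>S. a i * y i powr p)"
proof (cases "(\<Sum>i\<in>S. a i * y i) = 0")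
  case True
  then show ?thesis using a by (auto intro!: mult_nonneg_nonneg sum_nonneg)
next
  case False
  let ?T = "\<Sum>i\<in>S. a i * y i"
  have T: "?T > 0" using False a y by (simp add: order.not_eq_order_implies_strict sum_nonneg)
  have "A \<noteq> 0"
  proof
    assume "A = 0"
    \<comment> \<open>A sum over an infinite set is 0 by convention, so a nonzero sum forces
      finiteness.\<close>
    have fin: "finite S" using False sum.infinite by blast
    then have "\<forall>i\<in>S. a i = 0" using A a \<open>A = 0\<close> by (simp add: sum_nonneg_eq_0_iff)
    then show False using False by simp
  qed
  then have A0: "A > 0" using A a sum_nonneg[of S a] by fastforce
  define Y where "Y = ?T / A"
  have Y: "Y > 0" "?T = A * Y" using T A0 by (auto simp: Y_def)
  have "(\<Sum>i\<in>S. a i * (p * y i * Y powr (p - 1))) \<le> (\<Sum>i\<in>S. a i * (y i powr p + (p - 1) * Y powr p))"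
    by (intro sum_mono mult_left_mono powr_above_tangent a y Y p)
  moreover have "(\<Sum>i\<in>S. a i * (p * y i * Y powr (p - 1))) = p * ?T * Y powr (p - 1)"
    by (simp add: sum_distrib_left sum_distrib_right mult_ac)
  moreover have "(\<Sum>i\<in>S. a i * (y i powr p + (p - 1) * Y powr p))
      = (\<Sum>i\<in>S. a i * y i powr p) + A * ((p - 1) * Y powr p)"
    unfolding A[symmetric] by (simp add: sum_distrib_right sum.distrib distrib_left)
  moreover have "Y * Y powr (p - 1) = Y powr p"
    using Y by (simp add: powr_diff)
  then have "p * ?T * Y powr (p - 1) = p * A * Y powr p"
    using Y(2) by (simp add: mult_ac)
  ultimately have "p * A * Y powr p \<le> (\<Sum>i\<in>S. a i * y i powr p) + A * ((p - 1) * Y powr p)"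
    by (simp only:)
  then have "A * Y powr p \<le> (\<Sum>i\<in>S. a i * y i powr p)"
    by (simp add: algebra_simps)
  then have "A powr (p - 1) * (A * Y powr p) \<le> A powr (p - 1) * (\<Sum>i\<in>S. a i * y i powr p)"
    by (intro mult_left_mono) auto
  moreover have "A powr (p - 1) * (A * Y powr p) = ?T powr p"
    using A0 Y by (simp add: powr_mult powr_diff)
  ultimately show ?thesis by simp
qed

text \<open>The weight is unbounded at both ends, but its antiderivative \<open>- arccos\<close> has
  limits \<open>- pi\<close> and 0 there. For a nonnegative integrand the fundamental theorem yields
  integrability and value together.\<close>

lemma cheb_weight_integrable: "set_integrable lborel {-1<..<1} (\<lambda>x::real. 1 / sqrt (1 - x\<^sup>2))"
  and cheb_weight_integral: "(LBINT x=ereal (-1)..ereal 1. 1 / sqrt (1 - x\<^sup>2)) = pi"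
proof -
  let ?F = "\<lambda>x::real. - arccos x"
  have c: "continuous_on {-1..1} ?F" by (intro continuous_intros) auto
  have pos: "1 - x\<^sup>2 > 0" if "-1 < x" "x < 1" for x :: real
    using that by (simp add: abs_square_less_1)
  have D: "DERIV ?F x :> 1 / sqrt (1 - x\<^sup>2)" if "ereal (-1) < ereal x" "ereal x < ereal 1" for x
    using that by (auto intro!: derivative_eq_intros simp: field_simps)
  have C: "isCont (\<lambda>x. 1 / sqrt (1 - x\<^sup>2)) x" if "ereal (-1) < ereal x" "ereal x < ereal 1" for x
    using pos[of x] that by (intro continuous_intros) auto
  have N: "AE x in lborel. ereal (-1) < ereal x \<longrightarrow> ereal x < ereal 1 \<longrightarrow> 0 \<le> 1 / sqrt (1 - x\<^sup>2)"
    using pos by (auto intro!: AE_I2 simp: less_imp_le)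
  have L: "((?F \<circ> real_of_ereal) \<longlongrightarrow> - pi) (at_right (ereal (-1)))"
    unfolding ereal_tendsto_simps1 using continuous_on_Icc_at_rightD[OF c] by simp
  have R: "((?F \<circ> real_of_ereal) \<longlongrightarrow> 0) (at_left (ereal 1))"
    unfolding ereal_tendsto_simps1 using continuous_on_Icc_at_leftD[OF c] by simp
  have I: "einterval (ereal (-1)) (ereal 1) = {-1<..<1}" by (auto simp: einterval_def)
  have lt: "ereal (-1) < ereal 1" by simp
  note FTC = interval_integral_FTC_nonneg[OF lt D C N L R]
  show "set_integrable lborel {-1<..<1} (\<lambda>x::real. 1 / sqrt (1 - x\<^sup>2))"
    using FTC(1) unfolding I by simp
  show "(LBINT x=ereal (-1)..ereal 1. 1 / sqrt (1 - x\<^sup>2)) = pi" using FTC(2) by simp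
qed

lemma interval_integral_m1_1:
  "(LBINT x=ereal (-1)..ereal 1. f x) = (\<integral>x. indicator {-1<..<1} x * (f x :: real) \<partial>lborel)"
proof -
  have "einterval (ereal (-1)) (ereal 1) = {-1<..<1}" by (auto simp: einterval_def)
  then show ?thesis by (simp add: interval_lebesgue_integral_def set_lebesgue_integral_def)
qed

text \<open>For \<open>j > 0\<close> the antiderivative is a multiple of
  \<open>sin (j * arccos x)\<close>, which vanishes at both endpoints. The integrand changes sign,
  so integrability is obtained separately, by domination by a multiple of the weight.\<close>

lemma cheb_p_weight_integral:
  "has_bochner_integral lborel (\<lambda>x. indicator {-1<..<1} x * (cheb_p j x / sqrt (1 - x\<^sup>2)))
    (if j = 0 then sqrt pi else 0)"
proof (cases "j = 0")
  case True
  have "has_bochner_integral lborel (\<lambda>x. indicator {-1<..<1} x * (1 / sqrt (1 - x\<^sup>2))) pi"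
    using cheb_weight_integrable cheb_weight_integral
    unfolding interval_integral_m1_1 by (simp add: has_bochner_integral_iff set_integrable_def)
  from has_bochner_integral_mult_right[OF this, of "sqrt (1 / pi)"]
  have "has_bochner_integral lborel (\<lambda>x. indicator {-1<..<1} x * (cheb_p j x / sqrt (1 - x\<^sup>2)))
    (sqrt (1 / pi) * pi)"
    using True by (simp add: cheb_p_def mult_ac)
  also have "sqrt (1 / pi) * pi = sqrt pi"
    by (simp add: real_sqrt_divide real_div_sqrt)
  finally show ?thesis using True by simp
next
  case False
  let ?f = "\<lambda>x. cheb_p j x / sqrt (1 - x\<^sup>2)"
  let ?F = "\<lambda>x. - sqrt (2 / pi) * sin (real j * arccos x) / real j"
  have pos: "1 - x\<^sup>2 > 0" if "-1 < x" "x < 1" for x :: real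
    using that by (simp add: abs_square_less_1)
  have cf: "continuous_on {-1<..<1} ?f"
  proof -
    have "continuous_on {-1<..<1} (\<lambda>x. sqrt (2 / pi) * cos (real j * arccos x) / sqrt (1 - x\<^sup>2))"
      using pos by (intro continuous_intros) force+
    then show ?thesis using False by (simp add: cheb_p_def)
  qed
  have c: "continuous_on {-1..1} ?F" by (intro continuous_intros) (use False in auto)
  have D: "(?F has_vector_derivative ?f x) (at x)"
    if "ereal (-1) < ereal x" "ereal x < ereal 1" for x
    unfolding has_real_derivative_iff_has_vector_derivative[symmetric] cheb_p_def using that False pos[of x]
    by (auto intro!: derivative_eq_intros simp: field_simps)
  have C: "isCont ?f x" if "ereal (-1) < ereal x" "ereal x < ereal 1" for x
    using cf that by (auto simp: continuous_on_eq_continuous_at)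
  have L: "((?F \<circ> real_of_ereal) \<longlongrightarrow> 0) (at_right (ereal (-1)))"
    unfolding ereal_tendsto_simps1 using continuous_on_Icc_at_rightD[OF c] by simp
  have R: "((?F \<circ> real_of_ereal) \<longlongrightarrow> 0) (at_left (ereal 1))"
    unfolding ereal_tendsto_simps1 using continuous_on_Icc_at_leftD[OF c] by simp
  have I: "einterval (ereal (-1)) (ereal 1) = {-1<..<1}" by (auto simp: einterval_def)
  have lt: "ereal (-1) < ereal 1" by simp
  have si: "set_integrable lborel {-1<..<1} ?f"
  proof (rule set_integrable_bound)
    show "set_integrable lborel {-1<..<1} (\<lambda>x::real. sqrt (2 / pi) * (1 / sqrt (1 - x\<^sup>2)))"
      by (intro set_integrable_mult_right cheb_weight_integrable)
    show "set_borel_measurable lborel {-1<..<1} ?f"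
      unfolding set_borel_measurable_def
      using borel_measurable_continuous_on_indicator[OF _ cf] by simp
    have "sqrt (2 / pi) * \<bar>cos u\<bar> / s \<le> sqrt (2 / pi) / s" if "s \<ge> 0" for u s :: real
      using that by (intro divide_right_mono mult_right_le_one_le) auto
    then have "norm (?f x) \<le> norm (sqrt (2 / pi) * (1 / sqrt (1 - x\<^sup>2)))"
      if "x \<in> {-1<..<1}" for x
      using pos[of x] that False by (simp add: cheb_p_def abs_mult)
    then show "AE x in lborel. x \<in> {-1<..<1} \<longrightarrow> norm (?f x) \<le> norm (sqrt (2 / pi) * (1 / sqrt (1 - x\<^sup>2)))"
      by (intro AE_I2) blast
  qed
  then have "(LBINT x=ereal (-1)..ereal 1. ?f x) = 0 - 0"
    by (intro interval_integral_FTC_integrable[OF lt D C _ L R]) (auto simp: I)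
  then show ?thesis using False si
    unfolding interval_integral_m1_1 by (simp add: has_bochner_integral_iff set_integrable_def)
qed

text \<open>The continuous counterpart of the node mean: again only \<open>j = 0\<close> survives,
  contributing 1 for each \<open>l\<close>, whatever \<open>y\<close> is.\<close>

lemma cheb_fejer_weight_integral:
  "has_bochner_integral lborel (\<lambda>x. indicator {-1<..<1} x * (cheb_fejer k y x / sqrt (1 - x\<^sup>2)))
    (real (Suc k))"
proof -
  have "has_bochner_integral lborel (\<lambda>x. \<Sum>l\<le>k. \<Sum>j\<le>l. cheb_p j y *
      (indicator {-1<..<1} x * (cheb_p j x / sqrt (1 - x\<^sup>2))))
      (\<Sum>l\<le>k. \<Sum>j\<le>l. cheb_p j y * (if j = 0 then sqrt pi else 0))"
    by (intro has_bochner_integral_sum has_bochner_integral_mult_right cheb_p_weight_integral)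
  also have "(\<lambda>x. \<Sum>l\<le>k. \<Sum>j\<le>l. cheb_p j y * (indicator {-1<..<1} x * (cheb_p j x / sqrt (1 - x\<^sup>2))))
      = (\<lambda>x. indicator {-1<..<1} x * (cheb_fejer k y x / sqrt (1 - x\<^sup>2)))"
    unfolding cheb_fejer_def sum_divide_distrib sum_distrib_left by (simp add: mult_ac)
  also have "(\<Sum>l\<le>k. \<Sum>j\<le>l. cheb_p j y * (if j = 0 then sqrt pi else 0))
      = (\<Sum>l\<le>k. \<Sum>j\<le>l. if j = 0 then 1 else 0)"
    by (intro sum.cong refl) (auto simp: cheb_p_def real_sqrt_divide)
  also have "\<dots> = real (Suc k)" by simp
  finally show ?thesis .
qed

section \<open>The positive majorant and the norm bounds\<close>

definition vp_const :: "nat \<Rightarrow> nat \<Rightarrow> real" where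
  "vp_const n m = (\<Sum>k<2*n. \<bar>second_diff (vp_lam n m) k\<bar> * real (Suc k))"

text \<open>The twice summed kernel with coefficients replaced by absolute values. Its scaled sum
  over the nodes \<open>y\<close> and its weighted integral in \<open>x\<close> are both
  \<open>vp_const\<close>, which is what the finite-exponent bound rests on.\<close>

definition vp_major :: "nat \<Rightarrow> nat \<Rightarrow> real \<Rightarrow> real \<Rightarrow> real" where
  "vp_major n m y x = (\<Sum>k<2*n. \<bar>second_diff (vp_lam n m) k\<bar> * cheb_fejer k y x)"

lemma vp_const_nonneg: "0 \<le> vp_const n m"
  by (auto simp: vp_const_def intro!: sum_nonneg)

lemma vp_major_nonneg: "0 \<le> vp_major n m y x"
  by (auto simp: vp_major_def intro!: sum_nonneg mult_nonneg_nonneg cheb_fejer_nonneg)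

lemma sum_vp_major_cheb_nodes:
  "(\<Sum>i=1..n. pi / real n * vp_major n m (cheb_node n i) x) = vp_const n m"
proof -
  have "(\<Sum>i=1..n. pi / real n * vp_major n m (cheb_node n i) x)
      = (\<Sum>k<2*n. \<bar>second_diff (vp_lam n m) k\<bar> * (pi / real n * (\<Sum>i=1..n. cheb_fejer k (cheb_node n i) x)))"
    unfolding vp_major_def sum_distrib_left by (subst sum.swap) (simp add: mult_ac)
  also have "\<dots> = vp_const n m"
    unfolding vp_const_def by (intro sum.cong refl) (simp only: sum_cheb_fejer_cheb_nodes lessThan_iff)
  finally show ?thesis .
qed

lemma vp_major_weight_integral:
  "has_bochner_integral lborel (\<lambda>x. indicator {-1<..<1} x * (vp_major n m y x / sqrt (1 - x\<^sup>2)))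
    (vp_const n m)"
proof -
  have "has_bochner_integral lborel (\<lambda>x. \<Sum>k<2*n. \<bar>second_diff (vp_lam n m) k\<bar> *
      (indicator {-1<..<1} x * (cheb_fejer k y x / sqrt (1 - x\<^sup>2)))) (vp_const n m)"
    unfolding vp_const_def
    by (intro has_bochner_integral_sum has_bochner_integral_mult_right cheb_fejer_weight_integral)
  also have "(\<lambda>x. \<Sum>k<2*n. \<bar>second_diff (vp_lam n m) k\<bar> *
      (indicator {-1<..<1} x * (cheb_fejer k y x / sqrt (1 - x\<^sup>2))))
     = (\<lambda>x. indicator {-1<..<1} x * (vp_major n m y x / sqrt (1 - x\<^sup>2)))"
    unfolding vp_major_def sum_divide_distrib sum_distrib_left by (simp add: mult_ac)
  finally show ?thesis .
qed

lemma abs_vp_S_le_vp_major: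
  assumes "0 < m" "m < n"
  shows "\<bar>vp_S n m f x\<bar> \<le> (\<Sum>i=1..n. pi / real n * vp_major n m (cheb_node n i) x * \<bar>f (cheb_node n i)\<bar>)"
proof -
  let ?K = "\<lambda>i. \<Sum>r<n. cheb_p r (cheb_node n i) * vp_q n m r x / vp_nu n m r"
  have K: "\<bar>?K i\<bar> \<le> vp_major n m (cheb_node n i) x" if "i \<in> {1..n}" for i
  proof -
    \<comment> \<open>No boundary terms appear: \<open>m < n\<close> puts \<open>2 * n\<close> and
      \<open>2 * n + 1\<close> in the range where \<open>vp_lam\<close> is 0.\<close>
    have "?K i = (\<Sum>k<2*n. second_diff (vp_lam n m) k * cheb_fejer k (cheb_node n i) x)"
      unfolding vp_kernel_eq_vp_lam_sum[OF that assms] cheb_fejer_def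
      using assms by (intro sum_by_parts_twice vp_lam_eq_0) auto
    also have "\<bar>\<dots>\<bar> \<le> vp_major n m (cheb_node n i) x"
      unfolding vp_major_def
      by (rule order_trans[OF sum_abs]) (simp add: abs_mult cheb_fejer_nonneg)
    finally show ?thesis .
  qed
  have "\<bar>vp_S n m f x\<bar> = pi / real n * \<bar>\<Sum>i=1..n. f (cheb_node n i) * ?K i\<bar>"
    unfolding vp_S_eq_kernel_sum[OF assms] by (simp add: abs_mult)
  also have "\<dots> \<le> pi / real n * (\<Sum>i=1..n. \<bar>f (cheb_node n i) * ?K i\<bar>)"
    by (intro mult_left_mono sum_abs) simp
  also have "\<dots> \<le> pi / real n * (\<Sum>i=1..n. \<bar>f (cheb_node n i)\<bar> * vp_major n m (cheb_node n i) x)"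
    unfolding abs_mult by (intro mult_left_mono sum_mono K) auto
  also have "\<dots> = (\<Sum>i=1..n. pi / real n * vp_major n m (cheb_node n i) x * \<bar>f (cheb_node n i)\<bar>)"
    by (simp add: sum_distrib_left mult_ac)
  finally show ?thesis .
qed

lemma vp_S_pointwise_bound:
  assumes "0 < m" "m < n" and "\<And>i. i \<in> {1..n} \<Longrightarrow> \<bar>f (cheb_node n i)\<bar> \<le> B"
  shows "\<bar>vp_S n m f x\<bar> \<le> vp_const n m * B"
proof -
  have "\<bar>vp_S n m f x\<bar> \<le> (\<Sum>i=1..n. pi / real n * vp_major n m (cheb_node n i) x * \<bar>f (cheb_node n i)\<bar>)"
    by (rule abs_vp_S_le_vp_major[OF assms(1,2)])
  also have "\<dots> \<le> (\<Sum>i=1..n. pi / real n * vp_major n m (cheb_node n i) x * B)"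
    by (intro sum_mono mult_left_mono assms(3) mult_nonneg_nonneg vp_major_nonneg) auto
  also have "\<dots> = vp_const n m * B"
    by (simp only: sum_distrib_right[symmetric] sum_vp_major_cheb_nodes)
  finally show ?thesis .
qed

lemma w_norm_vp_S_le_infinity:
  assumes "0 < m" "m < n"
  shows "w_norm \<infinity> (vp_S n m f) \<le> vp_const n m * l_norm \<infinity> n f"
proof -
  have "\<bar>f (cheb_node n i)\<bar> \<le> l_norm \<infinity> n f" if "i \<in> {1..n}" for i
    using that unfolding l_norm_def by auto
  then show ?thesis unfolding w_norm_def sup_norm_def
    by (auto intro!: cSUP_least vp_S_pointwise_bound assms)
qed

text \<open>Jensen over the nodes costs \<open>?A powr (q - 1)\<close>, and integrating the majorant
  in \<open>x\<close> supplies one more factor \<open>?A\<close>. The \<open>q\<close>-th root of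
  \<open>?A powr q\<close> is again \<open>?A\<close>, so the constant does not depend on
  \<open>q\<close>.\<close>

lemma w_norm_vp_S_le_finite:
  assumes "0 < m" "m < n" "1 \<le> q"
  shows "w_norm (ereal q) (vp_S n m f) \<le> vp_const n m * l_norm (ereal q) n f"
proof -
  let ?A = "vp_const n m" and ?c = "\<lambda>i. pi / real n * \<bar>f (cheb_node n i)\<bar> powr q"
  let ?M = "\<lambda>i x. vp_major n m (cheb_node n i) x"
  let ?I = "indicator {-1<..<1} :: real \<Rightarrow> real"
  define G where "G x = ?A powr (q - 1) * (\<Sum>i=1..n. ?c i * (?I x * (?M i x / sqrt (1 - x\<^sup>2))))" for x
  have G: "has_bochner_integral lborel G (?A powr (q - 1) * (\<Sum>i=1..n. ?c i * ?A))"
    unfolding G_def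
    by (intro has_bochner_integral_mult_right has_bochner_integral_sum vp_major_weight_integral)
  have G0: "0 \<le> G x" for x
    unfolding G_def using vp_major_nonneg
    by (cases "x \<in> {-1<..<1}")
      (auto intro!: mult_nonneg_nonneg sum_nonneg divide_nonneg_nonneg simp: abs_square_le_1)
  have le: "?I x * (\<bar>vp_S n m f x\<bar> powr q / sqrt (1 - x\<^sup>2)) \<le> G x" for x
  proof (cases "x \<in> {-1<..<1}")
    case True
    have s: "sqrt (1 - x\<^sup>2) \<ge> 0" using True by (simp add: abs_square_le_1 abs_le_iff)
    have "\<bar>vp_S n m f x\<bar> powr q \<le> (\<Sum>i=1..n. pi / real n * ?M i x * \<bar>f (cheb_node n i)\<bar>) powr q"
      using assms by (intro powr_mono2 abs_vp_S_le_vp_major) auto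
    also have "\<dots> \<le> ?A powr (q - 1) * (\<Sum>i=1..n. pi / real n * ?M i x * \<bar>f (cheb_node n i)\<bar> powr q)"
      by (intro powr_weighted_sum_le sum_vp_major_cheb_nodes assms mult_nonneg_nonneg vp_major_nonneg) auto
    finally have "\<bar>vp_S n m f x\<bar> powr q / sqrt (1 - x\<^sup>2)
        \<le> ?A powr (q - 1) * (\<Sum>i=1..n. pi / real n * ?M i x * \<bar>f (cheb_node n i)\<bar> powr q) / sqrt (1 - x\<^sup>2)"
      using s by (rule divide_right_mono)
    also have "\<dots> = G x"
      using True by (simp add: G_def sum_divide_distrib sum_distrib_left mult_ac)
    finally show ?thesis using True by simp
  qed (use G0 in simp)
  \<comment> \<open>Integrability of \<open>G\<close> suffices here: a non-integrable left side
    would have integral 0 by convention, and \<open>G\<close> is nonnegative.\<close>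
  have "(LBINT x=ereal (-1)..ereal 1. \<bar>vp_S n m f x\<bar> powr q / sqrt (1 - x\<^sup>2)) \<le> (\<integral>x. G x \<partial>lborel)"
    unfolding interval_integral_m1_1 using G le G0
    by (intro integral_mono') (auto simp: has_bochner_integral_iff)
  also have "\<dots> = ?A powr (q - 1) * (\<Sum>i=1..n. ?c i * ?A)"
    using G by (simp add: has_bochner_integral_iff)
  also have "\<dots> = ?A powr q * (pi / real n * (\<Sum>i=1..n. \<bar>f (cheb_node n i)\<bar> powr q))"
  proof -
    have "?A powr (q - 1) * ?A = ?A powr q"
      using vp_const_nonneg[of n m] by (cases "?A = 0") (auto simp: powr_diff)
    moreover have "?A powr (q - 1) * (\<Sum>i=1..n. ?c i * ?A)
        = (?A powr (q - 1) * ?A) * (pi / real n * (\<Sum>i=1..n. \<bar>f (cheb_node n i)\<bar> powr q))"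
      by (simp add: sum_distrib_left mult_ac)
    ultimately show ?thesis by (simp only:)
  qed
  finally have le: "(LBINT x=ereal (-1)..ereal 1. \<bar>vp_S n m f x\<bar> powr q / sqrt (1 - x\<^sup>2))
      \<le> ?A powr q * (pi / real n * (\<Sum>i=1..n. \<bar>f (cheb_node n i)\<bar> powr q))" .
  have pos: "0 \<le> (LBINT x=ereal (-1)..ereal 1. \<bar>vp_S n m f x\<bar> powr q / sqrt (1 - x\<^sup>2))"
    unfolding interval_integral_m1_1
    by (intro integral_nonneg_AE AE_I2) (auto simp: indicator_def abs_square_le_1)
  have "w_norm (ereal q) (vp_S n m f)
      = (LBINT x=ereal (-1)..ereal 1. \<bar>vp_S n m f x\<bar> powr q / sqrt (1 - x\<^sup>2)) powr (1 / q)"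
    by (simp add: w_norm_def one_ereal_def)
  also have "\<dots> \<le> (?A powr q * (pi / real n * (\<Sum>i=1..n. \<bar>f (cheb_node n i)\<bar> powr q))) powr (1 / q)"
    using assms pos le by (intro powr_mono2) auto
  also have "\<dots> = (?A powr q) powr (1 / q) * (pi / real n * (\<Sum>i=1..n. \<bar>f (cheb_node n i)\<bar> powr q)) powr (1 / q)"
    by (rule powr_mult)
  also have "\<dots> = ?A * l_norm (ereal q) n f"
    using assms vp_const_nonneg[of n m] by (simp add: powr_powr l_norm_def)
  finally show ?thesis .
qed

section \<open>Polynomial reproduction and the error estimate\<close>

text \<open>Polynomial functions of degree at most \<open>N\<close> in the Chebyshev basis.
  Agreement is asked for on the interval only, because \<open>cos (arccos x) = x\<close> is
  available just there.\<close>

definition cheb_span :: "nat \<Rightarrow> (real \<Rightarrow> real) set" where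
  "cheb_span N = {g. \<exists>c. \<forall>x\<in>{-1..1}. g x = (\<Sum>j\<le>N. c j * cheb_p j x)}"

lemma cheb_span_add:
  assumes "g \<in> cheb_span N" "h \<in> cheb_span N"
  shows "(\<lambda>x. g x + h x) \<in> cheb_span N"
proof -
  obtain c d where "\<forall>x\<in>{-1..1}. g x = (\<Sum>j\<le>N. c j * cheb_p j x)"
    "\<forall>x\<in>{-1..1}. h x = (\<Sum>j\<le>N. d j * cheb_p j x)"
    using assms unfolding cheb_span_def by auto
  then have "\<forall>x\<in>{-1..1}. g x + h x = (\<Sum>j\<le>N. (c j + d j) * cheb_p j x)"
    by (simp add: sum.distrib distrib_right)
  then show ?thesis unfolding cheb_span_def by (auto intro!: exI[of _ "\<lambda>j. c j + d j"])
qed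

lemma cheb_span_scale:
  assumes "g \<in> cheb_span N"
  shows "(\<lambda>x. a * g x) \<in> cheb_span N"
proof -
  obtain c where "\<forall>x\<in>{-1..1}. g x = (\<Sum>j\<le>N. c j * cheb_p j x)"
    using assms unfolding cheb_span_def by auto
  then have "\<forall>x\<in>{-1..1}. a * g x = (\<Sum>j\<le>N. (a * c j) * cheb_p j x)"
    by (simp add: sum_distrib_left mult_ac)
  then show ?thesis unfolding cheb_span_def by (auto intro!: exI[of _ "\<lambda>j. a * c j"])
qed

lemma cheb_span_sum:
  assumes "\<And>i. i \<in> I \<Longrightarrow> g i \<in> cheb_span N"
  shows "(\<lambda>x. \<Sum>i\<in>I. g i x) \<in> cheb_span N"
  using assms
proof (induction I rule: infinite_finite_induct)
  case (insert i I)
  then show ?case using cheb_span_add[of "g i" N "\<lambda>x. \<Sum>i\<in>I. g i x"] by simp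
qed (auto simp: cheb_span_def intro!: exI[of _ "\<lambda>_. 0"])

lemma cheb_span_cong:
  assumes "g \<in> cheb_span N" "\<And>x. x \<in> {-1..1} \<Longrightarrow> g x = h x"
  shows "h \<in> cheb_span N"
  using assms unfolding cheb_span_def by auto

lemma cheb_p_in_cheb_span:
  assumes "j \<le> N"
  shows "cheb_p j \<in> cheb_span N"
proof -
  have "cheb_p j x = (\<Sum>i\<le>N. (if i = j then 1 else 0) * cheb_p i x)" for x
    using assms by (simp add: if_distrib[of "\<lambda>z. z * _"] cong: if_cong)
  then show ?thesis unfolding cheb_span_def by (auto intro!: exI[of _ "\<lambda>i. if i = j then 1 else 0"])
qed

lemma cos_arccos_in_cheb_span:
  assumes "j \<le> N"
  shows "(\<lambda>x. cos (real j * arccos x)) \<in> cheb_span N"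
proof -
  have "(\<lambda>x. cos (real j * arccos x)) = (\<lambda>x. (if j = 0 then sqrt pi else sqrt (pi / 2)) * cheb_p j x)"
    by (auto simp: fun_eq_iff cheb_p_def simp flip: real_sqrt_mult mult.assoc)
  then show ?thesis using cheb_span_scale[OF cheb_p_in_cheb_span[OF assms]] by simp
qed

lemma mult_cos_arccos:
  assumes "x \<in> {-1..1}"
  shows "x * cos (real (Suc j) * arccos x)
    = (cos (real (Suc (Suc j)) * arccos x) + cos (real j * arccos x)) / 2"
proof -
  have "cos (arccos x) * cos (real (Suc j) * arccos x)
    = (cos (real (Suc (Suc j)) * arccos x) + cos (real j * arccos x)) / 2"
    unfolding mult.commute[of "cos (arccos x)"] cos_times_cos by (simp add: algebra_simps)
  then show ?thesis using assms by simp
qed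

text \<open>Three-term recurrence: multiplication by \<open>x\<close> turns the cosine of index
  \<open>j > 0\<close> into the mean of its two neighbours, and index 0 into index 1.\<close>

lemma cheb_span_mult_x:
  assumes "g \<in> cheb_span N"
  shows "(\<lambda>x. x * g x) \<in> cheb_span (Suc N)"
proof -
  obtain c where c: "\<forall>x\<in>{-1..1}. g x = (\<Sum>j\<le>N. c j * cheb_p j x)"
    using assms unfolding cheb_span_def by auto
  have T: "(\<lambda>x. x * cos (real j * arccos x)) \<in> cheb_span (Suc N)" if "j \<le> N" for j
  proof (cases j)
    case 0
    show ?thesis
      by (rule cheb_span_cong[OF cos_arccos_in_cheb_span[of 1]]) (auto simp: 0)
  next
    case (Suc i)
    have "(\<lambda>x. 1 / 2 * (cos (real (Suc (Suc i)) * arccos x) + cos (real i * arccos x))) \<in> cheb_span (Suc N)"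
      using that Suc by (intro cheb_span_scale cheb_span_add cos_arccos_in_cheb_span) auto
    then show ?thesis
    proof (rule cheb_span_cong)
      fix x :: real assume "x \<in> {-1..1}"
      from mult_cos_arccos[OF this, of i]
      show "1 / 2 * (cos (real (Suc (Suc i)) * arccos x) + cos (real i * arccos x)) = x * cos (real j * arccos x)"
        unfolding Suc by simp
    qed
  qed
  have "(\<lambda>x. \<Sum>j\<le>N. (c j * (if j = 0 then sqrt (1 / pi) else sqrt (2 / pi))) * (x * cos (real j * arccos x)))
      \<in> cheb_span (Suc N)"
    by (intro cheb_span_sum cheb_span_scale T) auto
  then show ?thesis
  proof (rule cheb_span_cong)
    fix x :: real assume x: "x \<in> {-1..1}"
    show "(\<Sum>j\<le>N. (c j * (if j = 0 then sqrt (1 / pi) else sqrt (2 / pi))) * (x * cos (real j * arccos x))) = x * g x"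
      unfolding bspec[OF c x] sum_distrib_left by (intro sum.cong refl) (auto simp: cheb_p_def)
  qed
qed

text \<open>Horner's scheme: \<open>P = a + x * Q\<close> with \<open>Q\<close> of smaller
  degree.\<close>

lemma poly_in_cheb_span: "degree P \<le> N \<Longrightarrow> poly P \<in> cheb_span N"
proof (induction N arbitrary: P)
  case 0
  then obtain a where "P = [:a:]" by (auto elim: degree_eq_zeroE)
  have "(\<lambda>x. a * cos (real 0 * arccos x)) \<in> cheb_span 0"
    by (intro cheb_span_scale cos_arccos_in_cheb_span) simp
  then show ?case by (rule cheb_span_cong) (simp add: \<open>P = [:a:]\<close>)
next
  case (Suc N)
  obtain a Q where P: "P = pCons a Q" by (cases P)
  have "degree Q \<le> N" using Suc.prems P by (auto simp: degree_pCons_eq_if split: if_splits)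
  then have "poly Q \<in> cheb_span N" by (rule Suc.IH)
  then have "(\<lambda>x. a * cos (real 0 * arccos x) + x * poly Q x) \<in> cheb_span (Suc N)"
    by (intro cheb_span_add cheb_span_mult_x cheb_span_scale cos_arccos_in_cheb_span) auto
  then show ?case by (rule cheb_span_cong) (simp add: P)
qed

text \<open>These are the Chebyshev polynomials of the first kind, built by doubling
  \<open>x\<close> times the predecessor and subtracting the one before it.\<close>

lemma cos_arccos_eq_poly:
  "\<exists>P :: real poly. degree P \<le> r \<and> (\<forall>x\<in>{-1..1}. poly P x = cos (real r * arccos x))"
proof (induction r rule: less_induct)
  case (less r)
  consider "r = 0" | "r = 1" | j where "r = Suc (Suc j)" by (metis One_nat_def not0_implies_Suc)
  then show ?case
  proof cases
    case 1
    then show ?thesis by (intro exI[of _ 1]) simp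
  next
    case 2
    then show ?thesis by (intro exI[of _ "[:0, 1:]"]) simp
  next
    case (3 j)
    obtain P Q :: "real poly" where P: "degree P \<le> Suc j" "\<forall>x\<in>{-1..1}. poly P x = cos (real (Suc j) * arccos x)"
      and Q: "degree Q \<le> j" "\<forall>x\<in>{-1..1}. poly Q x = cos (real j * arccos x)"
      using less[of "Suc j"] less[of j] 3 by auto
    let ?R = "[:0, 2:] * P - Q"
    have "degree ([:0, 2:] * P) \<le> r"
      using degree_mult_le[of "[:0, 2:]" P] P(1) 3 by simp
    then have "degree ?R \<le> r" using Q(1) 3 by (intro degree_diff_le) auto
    moreover have "poly ?R x = cos (real r * arccos x)" if "x \<in> {-1..1}" for x
      using mult_cos_arccos[OF that, of j] P(2) Q(2) that 3 by simp
    ultimately show ?thesis by blast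
  qed
qed

lemma cheb_span_eq_poly:
  assumes "g \<in> cheb_span N"
  obtains P :: "real poly" where "degree P \<le> N" "\<And>x. x \<in> {-1..1} \<Longrightarrow> poly P x = g x"
proof -
  obtain c where c: "\<forall>x\<in>{-1..1}. g x = (\<Sum>j\<le>N. c j * cheb_p j x)"
    using assms unfolding cheb_span_def by auto
  obtain T :: "nat \<Rightarrow> real poly" where T: "\<And>r. degree (T r) \<le> r"
    "\<And>r x. x \<in> {-1..1} \<Longrightarrow> poly (T r) x = cos (real r * arccos x)"
    using cos_arccos_eq_poly by metis
  let ?P = "\<Sum>j\<le>N. smult (c j * (if j = 0 then sqrt (1 / pi) else sqrt (2 / pi))) (T j)"
  have "degree ?P \<le> N"
    using T(1) by (intro degree_sum_le) (auto intro: order_trans[OF degree_smult_le] order_trans)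
  moreover have "poly ?P x = g x" if "x \<in> {-1..1}" for x
    unfolding bspec[OF c that] poly_sum
    by (intro sum.cong refl) (auto simp: T(2)[OF that] cheb_p_def)
  ultimately show thesis using that by blast
qed

text \<open>The largest index occurring is \<open>2 * n - r\<close> with \<open>r > n - m\<close>,
  hence at most \<open>n + m - 1\<close>.\<close>

lemma vp_S_in_cheb_span:
  assumes "0 < m" "m < n"
  shows "vp_S n m f \<in> cheb_span (n + m - 1)"
proof -
  have q: "vp_q n m r \<in> cheb_span (n + m - 1)" if "r < n" for r
  proof (cases "r + m \<le> n")
    case True
    then have "vp_q n m r = cheb_p r" by (simp add: fun_eq_iff vp_q_def)
    then show ?thesis using that assms by (simp add: cheb_p_in_cheb_span)
  next
    case False
    have "(\<lambda>x. vp_mu n m r * cheb_p r x + (- vp_mu n m (2 * n - r)) * cheb_p (2 * n - r) x)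
        \<in> cheb_span (n + m - 1)"
      using that False by (intro cheb_span_add cheb_span_scale cheb_p_in_cheb_span) auto
    then show ?thesis by (rule cheb_span_cong) (use False in \<open>simp add: vp_q_def\<close>)
  qed
  show ?thesis unfolding vp_S_def vp_phi_def
    by (intro cheb_span_sum cheb_span_scale q) auto
qed

lemma vp_S_diff: "vp_S n m (\<lambda>x. f x - g x) x = vp_S n m f x - vp_S n m g x"
  unfolding vp_S_def by (simp add: left_diff_distrib right_diff_distrib sum_subtractf)

lemma cheb_node_in_Icc: "cheb_node n i \<in> {-1..1}"
  by (simp add: cheb_node_def)

text \<open>Linearity extends the reproduction of basis elements. The operator sees \<open>g\<close>
  only at the nodes, which lie in the interval where the expansion holds.\<close>

lemma vp_S_cheb_span:
  assumes "0 < m" "m < n" "g \<in> cheb_span (n - m)" "x \<in> {-1..1}"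
  shows "vp_S n m g x = g x"
proof -
  obtain c where c: "\<forall>x\<in>{-1..1}. g x = (\<Sum>j\<le>n - m. c j * cheb_p j x)"
    using assms unfolding cheb_span_def by auto
  define K where "K i = (\<Sum>r<n. cheb_p r (cheb_node n i) * vp_q n m r x / vp_nu n m r)" for i
  have S: "vp_S n m f x = pi / real n * (\<Sum>i=1..n. f (cheb_node n i) * K i)" for f
    unfolding K_def by (rule vp_S_eq_kernel_sum[OF assms(1,2)])
  have "vp_S n m g x = pi / real n * (\<Sum>i=1..n. \<Sum>j\<le>n - m. c j * (cheb_p j (cheb_node n i) * K i))"
    unfolding S bspec[OF c cheb_node_in_Icc] sum_distrib_right by (simp add: mult_ac)
  also have "\<dots> = (\<Sum>j\<le>n - m. c j * vp_S n m (cheb_p j) x)"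
    unfolding S sum_distrib_left by (subst sum.swap) (simp add: mult_ac)
  also have "\<dots> = (\<Sum>j\<le>n - m. c j * cheb_p j x)"
    using assms by (intro sum.cong refl) (simp add: vp_S_cheb_p)
  finally show ?thesis using c assms(4) by simp
qed

text \<open>Lebesgue's argument: as \<open>P\<close> is reproduced, the error of \<open>f\<close> is
  that of \<open>f - P\<close>, bounded by \<open>vp_const n m * B\<close> for the operator and
  \<open>B\<close> for the function.\<close>

lemma vp_S_error_le:
  assumes "0 < m" "m < n" "degree P \<le> n - m"
    and B: "\<And>x. x \<in> {-1..1} \<Longrightarrow> \<bar>f x - poly P x\<bar> \<le> B" and x: "x \<in> {-1..1}"
  shows "\<bar>vp_S n m f x - f x\<bar> \<le> (1 + vp_const n m) * B"
proof -
  have "vp_S n m (poly P) x = poly P x"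
    using assms by (intro vp_S_cheb_span poly_in_cheb_span) auto
  then have "vp_S n m f x - f x = vp_S n m (\<lambda>x. f x - poly P x) x - (f x - poly P x)"
    by (simp add: vp_S_diff)
  moreover have "\<bar>vp_S n m (\<lambda>x. f x - poly P x) x\<bar> \<le> vp_const n m * B"
    using assms(1,2) B cheb_node_in_Icc by (intro vp_S_pointwise_bound) auto
  ultimately show ?thesis using B[OF x] by (simp add: distrib_right)
qed

section \<open>Two-sided error estimate by best approximation\<close>

lemma sup_norm_upper:
  assumes "continuous_on {-1..1} g" "x \<in> {-1..1}"
  shows "\<bar>g x\<bar> \<le> sup_norm g"
  unfolding sup_norm_def
proof (rule cSUP_upper[OF assms(2)])
  have "compact ((\<lambda>x. \<bar>g x\<bar>) ` {-1..1})"
    using assms(1) by (intro compact_continuous_image continuous_intros) auto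
  then show "bdd_above ((\<lambda>x. \<bar>g x\<bar>) ` {-1..1})"
    by (intro bounded_imp_bdd_above compact_imp_bounded)
qed

lemma sup_norm_least:
  assumes "\<And>x. x \<in> {-1..1} \<Longrightarrow> \<bar>g x\<bar> \<le> B"
  shows "sup_norm g \<le> B"
  unfolding sup_norm_def using assms by (intro cSUP_least) auto

text \<open>On the interval \<open>vp_S n m f\<close> is itself a polynomial competing in the
  infimum.\<close>

lemma best_approx_le_vp_S_error:
  assumes "0 < m" "m < n" "continuous_on {-1..1} f"
  shows "best_approx (n + m - 1) f \<le> sup_norm (\<lambda>x. vp_S n m f x - f x)"
proof -
  obtain P :: "real poly" where P: "degree P \<le> n + m - 1" "\<And>x. x \<in> {-1..1} \<Longrightarrow> poly P x = vp_S n m f x"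
    using cheb_span_eq_poly[OF vp_S_in_cheb_span[OF assms(1,2)]] by blast
  have "sup_norm (\<lambda>x. f x - poly P x) = sup_norm (\<lambda>x. vp_S n m f x - f x)"
    unfolding sup_norm_def using P(2)
    by (intro arg_cong[where f=Sup] image_cong) (auto simp: abs_minus_commute)
  moreover have "best_approx (n + m - 1) f \<le> sup_norm (\<lambda>x. f x - poly P x)"
    unfolding best_approx_def
  proof (rule cINF_lower)
    have "0 \<le> sup_norm (\<lambda>x. f x - poly Q x)" for Q
    proof -
      have "continuous_on {-1..1} (\<lambda>x. f x - poly Q x)" using assms(3) by (intro continuous_intros)
      from sup_norm_upper[OF this, of 0] show ?thesis by simp
    qed
    then show "bdd_below ((\<lambda>P. sup_norm (\<lambda>x. f x - poly P x)) ` {P. degree P \<le> n + m - 1})"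
      by (intro bdd_belowI2[of _ 0])
  qed (use P(1) in simp)
  ultimately show ?thesis by simp
qed

lemma vp_S_error_le_best_approx:
  assumes "0 < m" "m < n" "continuous_on {-1..1} f" "vp_const n m \<le> A"
  shows "sup_norm (\<lambda>x. vp_S n m f x - f x) \<le> (1 + A) * best_approx (n - m) f"
proof -
  have A: "0 < 1 + A" using vp_const_nonneg[of n m] assms(4) by simp
  have "sup_norm (\<lambda>x. vp_S n m f x - f x) / (1 + A) \<le> best_approx (n - m) f"
    unfolding best_approx_def
  proof (rule cINF_greatest)
    show "{P :: real poly. degree P \<le> n - m} \<noteq> {}" by (auto intro: exI[of _ 0])
    fix P :: "real poly" assume "P \<in> {P. degree P \<le> n - m}"
    then have P: "degree P \<le> n - m" by simp
    let ?B = "sup_norm (\<lambda>x. f x - poly P x)"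
    have "continuous_on {-1..1} (\<lambda>x. f x - poly P x)" using assms(3) by (intro continuous_intros)
    note B = sup_norm_upper[OF this]
    have "sup_norm (\<lambda>x. vp_S n m f x - f x) \<le> (1 + vp_const n m) * ?B"
      by (intro sup_norm_least vp_S_error_le[OF assms(1,2) P]) (auto intro: B)
    also have "\<dots> \<le> (1 + A) * ?B"
      using assms(4) B[of 0] by (intro mult_right_mono) auto
    finally show "sup_norm (\<lambda>x. vp_S n m f x - f x) / (1 + A) \<le> ?B"
      using A by (simp add: field_simps)
  qed
  then show ?thesis using A by (simp add: field_simps)
qed

section \<open>Density of polynomials, the choice of \<open>m\<close>, and uniform
  convergence\<close>

lemma Weierstrass_poly:
  fixes f :: "real \<Rightarrow> real"
  assumes "continuous_on {a..b} f" "0 < e"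
  obtains P :: "real poly" where "\<And>x. x \<in> {a..b} \<Longrightarrow> \<bar>f x - poly P x\<bar> < e"
proof -
  obtain g where g: "real_polynomial_function g" "\<And>x. x \<in> {a..b} \<Longrightarrow> \<bar>f x - g x\<bar> < e"
    using Stone_Weierstrass_real_polynomial_function[OF compact_Icc assms] by blast
  obtain c N where "g = (\<lambda>x. \<Sum>i\<le>N. c i * x ^ i)"
    using g(1) unfolding real_polynomial_function_iff_sum by auto
  then have "poly (\<Sum>i\<le>N. monom (c i) i) x = g x" for x
    by (simp add: poly_sum poly_monom)
  then show thesis using g(2) that[of "\<Sum>i\<le>N. monom (c i) i"] by simp
qed

text \<open>From \<open>m \<ge> 1\<close> follows \<open>\<theta> * n < m + 1 \<le> 2 * m\<close>,
  so \<open>n / m \<le> 2 / \<theta>\<close>; with the bound \<open>40 * n / m\<close> this gives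
  \<open>80 / \<theta>\<close>.\<close>

lemma vp_parameter_bounds:
  fixes \<theta> :: real
  assumes "0 < \<theta>" "\<theta> < 1" "1 \<le> nat \<lfloor>\<theta> * real n\<rfloor>"
  shows "0 < nat \<lfloor>\<theta> * real n\<rfloor>" "nat \<lfloor>\<theta> * real n\<rfloor> < n" "vp_const n (nat \<lfloor>\<theta> * real n\<rfloor>) \<le> 80 / \<theta>"
proof -
  define m where "m = nat \<lfloor>\<theta> * real n\<rfloor>"
  have m: "0 < m" using assms(3) unfolding m_def by linarith
  then have n: "real n > 0" unfolding m_def by (cases "n = 0") auto
  have fl: "real m = of_int \<lfloor>\<theta> * real n\<rfloor>" using m unfolding m_def by simp
  have "real m \<le> \<theta> * real n" unfolding fl by simp
  also have "\<dots> < real n" using assms n by simp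
  finally have mn: "m < n" by simp
  have "\<theta> * real n < real m + 1" unfolding fl by linarith
  then have "\<theta> * real n \<le> 2 * real m" using m by linarith
  then have "real n / real m \<le> 2 / \<theta>" using m assms by (simp add: field_simps)
  then have "vp_const n m \<le> 80 / \<theta>"
    using sum_second_diff_vp_lam_le[OF m mn] unfolding vp_const_def by simp
  with m mn show "0 < nat \<lfloor>\<theta> * real n\<rfloor>" "nat \<lfloor>\<theta> * real n\<rfloor> < n"
      "vp_const n (nat \<lfloor>\<theta> * real n\<rfloor>) \<le> 80 / \<theta>" unfolding m_def by auto
qed

lemma vp_S_uniform_limit:
  fixes \<theta> :: real
  assumes \<theta>: "0 < \<theta>" "\<theta> < 1" and f: "continuous_on {-1..1} f"
  shows "uniform_limit {-1..1} (\<lambda>n. vp_S n (nat \<lfloor>\<theta> * real n\<rfloor>) f) f sequentially"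
proof (rule uniform_limitI)
  fix e :: real assume e: "0 < e"
  define A where "A = 80 / \<theta>"
  have A: "A > 0" using \<theta> by (simp add: A_def)
  \<comment> \<open>Chosen so that \<open>(1 + A) * d\<close> is \<open>e / 2\<close>.\<close>
  define d where "d = e / (2 * (1 + A))"
  have d: "d > 0" "(1 + A) * d < e" using e A by (simp_all add: d_def divide_less_eq mult.commute)
  obtain P :: "real poly" where P: "\<And>x. x \<in> {-1..1} \<Longrightarrow> \<bar>f x - poly P x\<bar> < d"
    using Weierstrass_poly[OF f d(1)] by blast
  \<comment> \<open>The first bound ensures \<open>m \<ge> 1\<close>; the second gives
    \<open>degree P \<le> (1 - \<theta>) * n \<le> n - m\<close>, so that \<open>P\<close> is
    reproduced.\<close>
  define N where "N = nat \<lceil>max (1 / \<theta>) (real (degree P) / (1 - \<theta>))\<rceil>"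
  have "\<forall>x\<in>{-1..1}. dist (vp_S n (nat \<lfloor>\<theta> * real n\<rfloor>) f x) (f x) < e" if "n \<ge> N" for n
  proof
    fix x :: real assume x: "x \<in> {-1..1}"
    let ?m = "nat \<lfloor>\<theta> * real n\<rfloor>"
    have "max (1 / \<theta>) (real (degree P) / (1 - \<theta>)) \<le> real n"
      using that unfolding N_def by linarith
    then have "1 / \<theta> \<le> real n" "real (degree P) / (1 - \<theta>) \<le> real n" by auto
    then have n: "1 \<le> \<theta> * real n" "real (degree P) \<le> real n - \<theta> * real n"
      using \<theta> by (simp_all add: field_simps)
    have m1: "1 \<le> ?m" using n(1) by linarith
    note b = vp_parameter_bounds[OF \<theta> m1]
    have "real ?m \<le> \<theta> * real n" using n(1) by linarith
    then have "degree P \<le> n - ?m" using n(2) b(2) by linarith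
    then have "\<bar>vp_S n ?m f x - f x\<bar> \<le> (1 + vp_const n ?m) * d"
      using P x by (intro vp_S_error_le b) (auto intro: less_imp_le)
    also have "\<dots> \<le> (1 + A) * d" using b(3) d(1) unfolding A_def by (intro mult_right_mono) auto
    also have "\<dots> < e" by (rule d(2))
    finally show "dist (vp_S n ?m f x) (f x) < e" by (simp add: dist_real_def)
  qed
  then show "\<forall>\<^sub>F n in sequentially. \<forall>x\<in>{-1..1}. dist (vp_S n (nat \<lfloor>\<theta> * real n\<rfloor>) f x) (f x) < e"
    unfolding eventually_sequentially by blast
qed

lemma w_norm_vp_S_le:
  assumes "0 < m" "m < n" "1 \<le> p"
  shows "w_norm p (vp_S n m f) \<le> vp_const n m * l_norm p n f"
proof (cases p)
  case (real q)
  then show ?thesis using assms by (simp add: w_norm_vp_S_le_finite one_ereal_def)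
qed (use assms in \<open>auto simp: w_norm_vp_S_le_infinity\<close>)

lemma l_norm_nonneg: "0 < n \<Longrightarrow> 0 \<le> l_norm p n f"
proof -
  assume "0 < n"
  then have "\<bar>f (cheb_node n 1)\<bar> \<le> Max ((\<lambda>k. \<bar>f (cheb_node n k)\<bar>) ` {1..n})"
    by (intro Max_ge) auto
  then show ?thesis by (auto simp: l_norm_def)
qed

theorem theorem3:
  fixes \<theta> :: real
  assumes "0 < \<theta>" and "\<theta> < 1"
  shows "(\<forall>p::ereal. 1 \<le> p \<longrightarrow>
            (\<exists>C>0. \<forall>(n::nat) (f::real \<Rightarrow> real). 1 \<le> nat \<lfloor>\<theta> * real n\<rfloor> \<longrightarrow>
               w_norm p (vp_S n (nat \<lfloor>\<theta> * real n\<rfloor>) f) \<le> C * l_norm p n f))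
       \<and> (\<forall>f::real \<Rightarrow> real. continuous_on {-1..1} f \<longrightarrow>
            uniform_limit {-1..1} (\<lambda>n. vp_S n (nat \<lfloor>\<theta> * real n\<rfloor>) f) f sequentially)
       \<and> (\<exists>C>0. \<forall>(n::nat) (f::real \<Rightarrow> real). continuous_on {-1..1} f \<longrightarrow> 1 \<le> nat \<lfloor>\<theta> * real n\<rfloor> \<longrightarrow>
            best_approx (n + nat \<lfloor>\<theta> * real n\<rfloor> - 1) f
              \<le> sup_norm (\<lambda>x. vp_S n (nat \<lfloor>\<theta> * real n\<rfloor>) f x - f x)
            \<and> sup_norm (\<lambda>x. vp_S n (nat \<lfloor>\<theta> * real n\<rfloor>) f x - f x)
              \<le> C * best_approx (n - nat \<lfloor>\<theta> * real n\<rfloor>) f)"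
proof (intro conjI allI impI)
  note b = vp_parameter_bounds[OF assms]
  fix p :: ereal assume p: "1 \<le> p"
  have "w_norm p (vp_S n (nat \<lfloor>\<theta> * real n\<rfloor>) f) \<le> 80 / \<theta> * l_norm p n f"
    if "1 \<le> nat \<lfloor>\<theta> * real n\<rfloor>" for n f
  proof -
    have "w_norm p (vp_S n (nat \<lfloor>\<theta> * real n\<rfloor>) f) \<le> vp_const n (nat \<lfloor>\<theta> * real n\<rfloor>) * l_norm p n f"
      by (rule w_norm_vp_S_le[OF b(1,2)[OF that] p])
    also have "\<dots> \<le> 80 / \<theta> * l_norm p n f"
      using b[OF that] by (intro mult_right_mono l_norm_nonneg) auto
    finally show ?thesis .
  qed
  then show "\<exists>C>0. \<forall>n f. 1 \<le> nat \<lfloor>\<theta> * real n\<rfloor> \<longrightarrow>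
      w_norm p (vp_S n (nat \<lfloor>\<theta> * real n\<rfloor>) f) \<le> C * l_norm p n f"
    using assms by (intro exI[of _ "80 / \<theta>"]) auto
next
  fix f :: "real \<Rightarrow> real" assume "continuous_on {-1..1} f"
  then show "uniform_limit {-1..1} (\<lambda>n. vp_S n (nat \<lfloor>\<theta> * real n\<rfloor>) f) f sequentially"
    by (rule vp_S_uniform_limit[OF assms])
next
  note b = vp_parameter_bounds[OF assms]
  \<comment> \<open>The operator accounts for \<open>80 / \<theta>\<close>, the function
    \<open>f - P\<close> itself for the extra 1.\<close>
  have "1 + 80 / \<theta> > 0" using assms by (simp add: add_pos_pos)
  then show "\<exists>C>0. \<forall>n f. continuous_on {-1..1} f \<longrightarrow> 1 \<le> nat \<lfloor>\<theta> * real n\<rfloor> \<longrightarrow>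
      best_approx (n + nat \<lfloor>\<theta> * real n\<rfloor> - 1) f
        \<le> sup_norm (\<lambda>x. vp_S n (nat \<lfloor>\<theta> * real n\<rfloor>) f x - f x)
      \<and> sup_norm (\<lambda>x. vp_S n (nat \<lfloor>\<theta> * real n\<rfloor>) f x - f x)
        \<le> C * best_approx (n - nat \<lfloor>\<theta> * real n\<rfloor>) f"
    using b best_approx_le_vp_S_error vp_S_error_le_best_approx
    by (intro exI[of _ "1 + 80 / \<theta>"] conjI allI impI) auto
qed

end
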